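(* Given any finite constant specification $\mathsf{CS}$ for $\mathsf{S4LPN}$, and any sequent $\Gamma\Rightarrow\Delta$ in the language of $\mathsf{G3S4LPN}^e_{\mathsf{CS}}$, it is decidable whether the sequent is derivable in $\mathsf{G3S4LPN}^e_{\mathsf{CS}}$. The same holds for $\mathsf{S4LP}$ and $\mathsf{G3S4LP}^e_{\mathsf{CS}}$ (with $\mathsf{CS}$ a finite constant specification for $\mathsf{S4LP}$).
   Context: Logics. Terms are built from justification variables and constants by binary $\cdot,+$ and unary $!$. Formulas are built from propositional variables and $\bot$ by $\neg,\wedge,\vee,\to$, $t:A$ ($t$ a term) and $\Box A$. Axiom schemes of $\mathsf{S4LP}$: propositional tautologies; $\Box(A\to B)\to(\Box A\to\Box B)$; $\Box A\to A$; $\Box A\to\Box\Box A$; $s:A\to(s+t):A$, $s:A\to(t+s):A$; $s:(A\to B)\to(t:A\to(s\cdot t):B)$; $t:A\to A$; $t:A\to\,!t:t:A$; $t:A\to\Box A$. $\mathsf{S4LPN}$ has in addition $\neg t:A\to\Box\neg t:A$. A constant specification for either logic is a set of formulas $c:A$ with $c$ a constant and $A$ an axiom instance of that logic. Calculus $\mathsf{G3S4LPN}^e_{\mathsf{CS}}$. Fix a countably infinite set of labels $w,v,u,\dots$. The labeled language has labeled formulas $w\Vvdash A$, relational atoms $wRv$, evidence relational atoms $wR^ev$, and evidence atoms $wE(t,A)$ ($A$ a formula, $t$ a term). Sequents $\Gamma\Rightarrow\Delta$ consist of finite multisets of these. Initial sequents: $w\Vvdash P,\Gamma\Rightarrow\Delta,w\Vvdash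 P$ ($P$ a propositional variable); $w\Vvdash\bot,\Gamma\Rightarrow\Delta$; $wRv,\Gamma\Rightarrow\Delta,wRv$; $wR^ev,\Gamma\Rightarrow\Delta,wR^ev$; $wE(t,A),\Gamma\Rightarrow\Delta,wE(t,A)$. Rules (premises / conclusion): (L$\neg$) $\Gamma\Rightarrow\Delta,w\Vvdash A$ / $w\Vvdash\neg A,\Gamma\Rightarrow\Delta$; (R$\neg$) $w\Vvdash A,\Gamma\Rightarrow\Delta$ / $\Gamma\Rightarrow\Delta,w\Vvdash\neg A$; (L$\wedge$) $w\Vvdash A,w\Vvdash B,\Gamma\Rightarrow\Delta$ / $w\Vvdash A\wedge B,\Gamma\Rightarrow\Delta$; (R$\wedge$) $\Gamma\Rightarrow\Delta,w\Vvdash A$ and $\Gamma\Rightarrow\Delta,w\Vvdash B$ / $\Gamma\Rightarrow\Delta,w\Vvdash A\wedge B$; (L$\vee$) $w\Vvdash A,\Gamma\Rightarrow\Delta$ and $w\Vvdash B,\Gamma\Rightarrow\Delta$ / $w\Vvdash A\vee B,\Gamma\Rightarrow\Delta$; (R$\vee$) $\Gamma\Rightarrow\Delta,w\Vvdash A,w\Vvdash B$ / $\Gamma\Rightarrow\Delta,w\Vvdash A\vee B$; (L$\to$) $\Gamma\Rightarrow\Delta,w\Vvdash A$ and $w\Vvdash B,\Gamma\Rightarrow\Delta$ / $w\Vvdash A\to B,\Gamma\Rightarrow\Delta$; (R$\to$) $w\Vvdash A,\Gamma\Rightarrow\Delta,w\Vvdash B$ / $\Gamma\Rightarrow\Delta,w\Vvdash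 A\to B$; (L$\Box$) $v\Vvdash A,w\Vvdash\Box A,wRv,\Gamma\Rightarrow\Delta$ / $w\Vvdash\Box A,wRv,\Gamma\Rightarrow\Delta$; (R$\Box$) $wRv,\Gamma\Rightarrow\Delta,v\Vvdash A$ / $\Gamma\Rightarrow\Delta,w\Vvdash\Box A$, where $v$ does not occur in the conclusion; (Ref) $wRw,\Gamma\Rightarrow\Delta$ / $\Gamma\Rightarrow\Delta$; (Trans) $wRu,wRv,vRu,\Gamma\Rightarrow\Delta$ / $wRv,vRu,\Gamma\Rightarrow\Delta$; (L:$^e$) $v\Vvdash A,w\Vvdash t:A,wR^ev,\Gamma\Rightarrow\Delta$ / $w\Vvdash t:A,wR^ev,\Gamma\Rightarrow\Delta$; (R:$^e$) $wR^ev,wE(t,A),\Gamma\Rightarrow\Delta,v\Vvdash A$ / $wE(t,A),\Gamma\Rightarrow\Delta,w\Vvdash t:A$, where $v$ does not occur in the conclusion; (E) $wE(t,A),w\Vvdash t:A,\Gamma\Rightarrow\Delta$ / $w\Vvdash t:A,\Gamma\Rightarrow\Delta$; (E$\cdot$) $wE(s\cdot t,B),wE(s,A\to B),wE(t,A),\Gamma\Rightarrow\Delta$ / $wE(s,A\to B),wE(t,A),\Gamma\Rightarrow\Delta$; (El+) $wE(s+t,A),wE(t,A),\Gamma\Rightarrow\Delta$ / $wE(t,A),\Gamma\Rightarrow\Delta$; (Er+) $wE(t+s,A),wE(t,A),\Gamma\Rightarrow\Delta$ / $wE(t,A),\Gamma\Rightarrow\Delta$; (E!) $wE(!t,t:A),wE(t,A),\Gamma\Rightarrow\Delta$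 / $wE(t,A),\Gamma\Rightarrow\Delta$; (Mon$^e$) $vE(t,A),wE(t,A),wR^ev,\Gamma\Rightarrow\Delta$ / $wE(t,A),wR^ev,\Gamma\Rightarrow\Delta$; (AN) $wE(c,A),\Gamma\Rightarrow\Delta$ / $\Gamma\Rightarrow\Delta$, for $c:A\in\mathsf{CS}$; ($R^e$) $wR^ev,wRv,\Gamma\Rightarrow\Delta$ / $wRv,\Gamma\Rightarrow\Delta$; (Ref$^e$) $wR^ew,\Gamma\Rightarrow\Delta$ / $\Gamma\Rightarrow\Delta$; (Sym$^e$) $vR^ew,wR^ev,\Gamma\Rightarrow\Delta$ / $wR^ev,\Gamma\Rightarrow\Delta$; (Trans$^e$) $wR^eu,wR^ev,vR^eu,\Gamma\Rightarrow\Delta$ / $wR^ev,vR^eu,\Gamma\Rightarrow\Delta$. The calculus $\mathsf{G3S4LP}^e_{\mathsf{CS}}$ (for $\mathsf{CS}$ a constant specification for $\mathsf{S4LP}$) is the same without the rule (Sym$^e$). *)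

theory Defs
  imports "HOL-Library.Multiset" "HOL-Library.Nat_Bijection"
begin

text \<open>Justification variables, constants, propositional variables and labels each range over a
  countably infinite set, here \<^typ>\<open>nat\<close>.\<close>

datatype tm =
    JVar nat
  | JConst nat
  | App tm tm   (infixl "\<^bold>\<cdot>" 75)
  | Sum tm tm   (infixl "\<^bold>+" 70)
  | Bang tm     ("\<^bold>! _" [80] 80)

datatype fm =
    PVar nat
  | Falsum      ("\<^bold>\<bottom>")
  | Neg fm      ("\<^bold>\<not> _" [68] 68)
  | Con fm fm   (infixr "\<^bold>\<and>" 64)
  | Dis fm fm   (infixr "\<^bold>\<or>" 63)
  | Imp fm fm   (infixr "\<^bold>\<rightarrow>" 62)
  | Just tm fm  ("_ \<^bold>: _" [69, 68] 68)
  | Box fm      ("\<^bold>\<box> _" [68] 68)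

datatype logic = S4LP | S4LPN


subsection \<open>Axioms and constant specifications\<close>

text \<open>A formula of the full language is a propositional tautology if it is true under every Boolean
  valuation in which propositional variables and formulas of the form \<open>t \<^bold>: A\<close> and \<open>\<^bold>\<box> A\<close> are
  treated as atoms.\<close>

fun bool_eval :: "(fm \<Rightarrow> bool) \<Rightarrow> fm \<Rightarrow> bool" where
  "bool_eval V (PVar p) \<longleftrightarrow> V (PVar p)"
| "bool_eval V \<^bold>\<bottom> \<longleftrightarrow> False"
| "bool_eval V (\<^bold>\<not> A) \<longleftrightarrow> \<not> bool_eval V A"
| "bool_eval V (A \<^bold>\<and> B) \<longleftrightarrow> bool_eval V A \<and> bool_eval V B"
| "bool_eval V (A \<^bold>\<or> B) \<longleftrightarrow> bool_eval V A \<or> bool_eval V B"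
| "bool_eval V (A \<^bold>\<rightarrow> B) \<longleftrightarrow> (bool_eval V A \<longrightarrow> bool_eval V B)"
| "bool_eval V (t \<^bold>: A) \<longleftrightarrow> V (t \<^bold>: A)"
| "bool_eval V (\<^bold>\<box> A) \<longleftrightarrow> V (\<^bold>\<box> A)"

definition tautology :: "fm \<Rightarrow> bool" where
  "tautology A \<longleftrightarrow> (\<forall>V. bool_eval V A)"

inductive axiom_inst :: "logic \<Rightarrow> fm \<Rightarrow> bool" for L where
  Taut: "tautology A \<Longrightarrow> axiom_inst L A"
| K: "axiom_inst L (\<^bold>\<box> (A \<^bold>\<rightarrow> B) \<^bold>\<rightarrow> (\<^bold>\<box> A \<^bold>\<rightarrow> \<^bold>\<box> B))"
| T: "axiom_inst L (\<^bold>\<box> A \<^bold>\<rightarrow> A)"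
| Four: "axiom_inst L (\<^bold>\<box> A \<^bold>\<rightarrow> \<^bold>\<box> \<^bold>\<box> A)"
| SumL: "axiom_inst L ((s \<^bold>: A) \<^bold>\<rightarrow> ((s \<^bold>+ t) \<^bold>: A))"
| SumR: "axiom_inst L ((s \<^bold>: A) \<^bold>\<rightarrow> ((t \<^bold>+ s) \<^bold>: A))"
| JK: "axiom_inst L ((s \<^bold>: (A \<^bold>\<rightarrow> B)) \<^bold>\<rightarrow> ((t \<^bold>: A) \<^bold>\<rightarrow> ((s \<^bold>\<cdot> t) \<^bold>: B)))"
| JT: "axiom_inst L ((t \<^bold>: A) \<^bold>\<rightarrow> A)"
| JFour: "axiom_inst L ((t \<^bold>: A) \<^bold>\<rightarrow> ((\<^bold>! t) \<^bold>: (t \<^bold>: A)))"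
| Conn: "axiom_inst L ((t \<^bold>: A) \<^bold>\<rightarrow> \<^bold>\<box> A)"
| NegIntro: "L = S4LPN \<Longrightarrow> axiom_inst L ((\<^bold>\<not> (t \<^bold>: A)) \<^bold>\<rightarrow> \<^bold>\<box> (\<^bold>\<not> (t \<^bold>: A)))"

definition constant_spec :: "logic \<Rightarrow> fm set \<Rightarrow> bool" where
  "constant_spec L CS \<longleftrightarrow> (\<forall>F\<in>CS. \<exists>c A. F = (JConst c \<^bold>: A) \<and> axiom_inst L A)"


subsection \<open>The labeled sequent calculi\<close>

type_synonym label = nat

datatype item =
    Forces label fm    ("_ \<^bold>\<tturnstile> _" [57, 57] 56)
  | Rel label label
  | ERel label label
  | Evid label tm fm

fun labels :: "item \<Rightarrow> label set" where
  "labels (w \<^bold>\<tturnstile> A) = {w}"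
| "labels (Rel w v) = {w, v}"
| "labels (ERel w v) = {w, v}"
| "labels (Evid w t A) = {w}"

definition occurs :: "label \<Rightarrow> item multiset \<Rightarrow> bool" where
  "occurs v \<Gamma> \<longleftrightarrow> (\<exists>x\<in>#\<Gamma>. v \<in> labels x)"

text \<open>\<open>G3 S4LPN CS\<close> and \<open>G3 S4LP CS\<close> are derivability in the two calculi; they differ only in
  the rule \<open>SymE\<close>.\<close>

inductive G3 :: "logic \<Rightarrow> fm set \<Rightarrow> item multiset \<Rightarrow> item multiset \<Rightarrow> bool" for L CS where
  InitP: "G3 L CS (add_mset (w \<^bold>\<tturnstile> PVar p) \<Gamma>) (add_mset (w \<^bold>\<tturnstile> PVar p) \<Delta>)"
| InitBot: "G3 L CS (add_mset (w \<^bold>\<tturnstile> \<^bold>\<bottom>) \<Gamma>) \<Delta>"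
| InitR: "G3 L CS (add_mset (Rel w v) \<Gamma>) (add_mset (Rel w v) \<Delta>)"
| InitRE: "G3 L CS (add_mset (ERel w v) \<Gamma>) (add_mset (ERel w v) \<Delta>)"
| InitE: "G3 L CS (add_mset (Evid w t A) \<Gamma>) (add_mset (Evid w t A) \<Delta>)"
| LNeg: "G3 L CS \<Gamma> (add_mset (w \<^bold>\<tturnstile> A) \<Delta>)
    \<Longrightarrow> G3 L CS (add_mset (w \<^bold>\<tturnstile> \<^bold>\<not> A) \<Gamma>) \<Delta>"
| RNeg: "G3 L CS (add_mset (w \<^bold>\<tturnstile> A) \<Gamma>) \<Delta>
    \<Longrightarrow> G3 L CS \<Gamma> (add_mset (w \<^bold>\<tturnstile> \<^bold>\<not> A) \<Delta>)"
| LCon: "G3 L CS (add_mset (w \<^bold>\<tturnstile> A) (add_mset (w \<^bold>\<tturnstile> B) \<Gamma>)) \<Delta>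
    \<Longrightarrow> G3 L CS (add_mset (w \<^bold>\<tturnstile> A \<^bold>\<and> B) \<Gamma>) \<Delta>"
| RCon: "G3 L CS \<Gamma> (add_mset (w \<^bold>\<tturnstile> A) \<Delta>) \<Longrightarrow> G3 L CS \<Gamma> (add_mset (w \<^bold>\<tturnstile> B) \<Delta>)
    \<Longrightarrow> G3 L CS \<Gamma> (add_mset (w \<^bold>\<tturnstile> A \<^bold>\<and> B) \<Delta>)"
| LDis: "G3 L CS (add_mset (w \<^bold>\<tturnstile> A) \<Gamma>) \<Delta> \<Longrightarrow> G3 L CS (add_mset (w \<^bold>\<tturnstile> B) \<Gamma>) \<Delta>
    \<Longrightarrow> G3 L CS (add_mset (w \<^bold>\<tturnstile> A \<^bold>\<or> B) \<Gamma>) \<Delta>"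
| RDis: "G3 L CS \<Gamma> (add_mset (w \<^bold>\<tturnstile> A) (add_mset (w \<^bold>\<tturnstile> B) \<Delta>))
    \<Longrightarrow> G3 L CS \<Gamma> (add_mset (w \<^bold>\<tturnstile> A \<^bold>\<or> B) \<Delta>)"
| LImp: "G3 L CS \<Gamma> (add_mset (w \<^bold>\<tturnstile> A) \<Delta>) \<Longrightarrow> G3 L CS (add_mset (w \<^bold>\<tturnstile> B) \<Gamma>) \<Delta>
    \<Longrightarrow> G3 L CS (add_mset (w \<^bold>\<tturnstile> A \<^bold>\<rightarrow> B) \<Gamma>) \<Delta>"
| RImp: "G3 L CS (add_mset (w \<^bold>\<tturnstile> A) \<Gamma>) (add_mset (w \<^bold>\<tturnstile> B) \<Delta>)
    \<Longrightarrow> G3 L CS \<Gamma> (add_mset (w \<^bold>\<tturnstile> A \<^bold>\<rightarrow> B) \<Delta>)"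
| LBox: "G3 L CS (add_mset (v \<^bold>\<tturnstile> A) (add_mset (w \<^bold>\<tturnstile> \<^bold>\<box> A) (add_mset (Rel w v) \<Gamma>))) \<Delta>
    \<Longrightarrow> G3 L CS (add_mset (w \<^bold>\<tturnstile> \<^bold>\<box> A) (add_mset (Rel w v) \<Gamma>)) \<Delta>"
| RBox: "G3 L CS (add_mset (Rel w v) \<Gamma>) (add_mset (v \<^bold>\<tturnstile> A) \<Delta>)
    \<Longrightarrow> \<not> occurs v \<Gamma> \<Longrightarrow> \<not> occurs v (add_mset (w \<^bold>\<tturnstile> \<^bold>\<box> A) \<Delta>)
    \<Longrightarrow> G3 L CS \<Gamma> (add_mset (w \<^bold>\<tturnstile> \<^bold>\<box> A) \<Delta>)"
| Ref: "G3 L CS (add_mset (Rel w w) \<Gamma>) \<Delta> \<Longrightarrow> G3 L CS \<Gamma> \<Delta>"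
| Trans: "G3 L CS (add_mset (Rel w u) (add_mset (Rel w v) (add_mset (Rel v u) \<Gamma>))) \<Delta>
    \<Longrightarrow> G3 L CS (add_mset (Rel w v) (add_mset (Rel v u) \<Gamma>)) \<Delta>"
| LJust: "G3 L CS (add_mset (v \<^bold>\<tturnstile> A) (add_mset (w \<^bold>\<tturnstile> t \<^bold>: A) (add_mset (ERel w v) \<Gamma>))) \<Delta>
    \<Longrightarrow> G3 L CS (add_mset (w \<^bold>\<tturnstile> t \<^bold>: A) (add_mset (ERel w v) \<Gamma>)) \<Delta>"
| RJust: "G3 L CS (add_mset (ERel w v) (add_mset (Evid w t A) \<Gamma>)) (add_mset (v \<^bold>\<tturnstile> A) \<Delta>)
    \<Longrightarrow> \<not> occurs v (add_mset (Evid w t A) \<Gamma>) \<Longrightarrow> \<not> occurs v (add_mset (w \<^bold>\<tturnstile> t \<^bold>: A) \<Delta>)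
    \<Longrightarrow> G3 L CS (add_mset (Evid w t A) \<Gamma>) (add_mset (w \<^bold>\<tturnstile> t \<^bold>: A) \<Delta>)"
| E: "G3 L CS (add_mset (Evid w t A) (add_mset (w \<^bold>\<tturnstile> t \<^bold>: A) \<Gamma>)) \<Delta>
    \<Longrightarrow> G3 L CS (add_mset (w \<^bold>\<tturnstile> t \<^bold>: A) \<Gamma>) \<Delta>"
| EApp: "G3 L CS (add_mset (Evid w (s \<^bold>\<cdot> t) B)
        (add_mset (Evid w s (A \<^bold>\<rightarrow> B)) (add_mset (Evid w t A) \<Gamma>))) \<Delta>
    \<Longrightarrow> G3 L CS (add_mset (Evid w s (A \<^bold>\<rightarrow> B)) (add_mset (Evid w t A) \<Gamma>)) \<Delta>"
| ElSum: "G3 L CS (add_mset (Evid w (s \<^bold>+ t) A) (add_mset (Evid w t A) \<Gamma>)) \<Delta>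
    \<Longrightarrow> G3 L CS (add_mset (Evid w t A) \<Gamma>) \<Delta>"
| ErSum: "G3 L CS (add_mset (Evid w (t \<^bold>+ s) A) (add_mset (Evid w t A) \<Gamma>)) \<Delta>
    \<Longrightarrow> G3 L CS (add_mset (Evid w t A) \<Gamma>) \<Delta>"
| EBang: "G3 L CS (add_mset (Evid w (\<^bold>! t) (t \<^bold>: A)) (add_mset (Evid w t A) \<Gamma>)) \<Delta>
    \<Longrightarrow> G3 L CS (add_mset (Evid w t A) \<Gamma>) \<Delta>"
| MonE: "G3 L CS (add_mset (Evid v t A) (add_mset (Evid w t A) (add_mset (ERel w v) \<Gamma>))) \<Delta>
    \<Longrightarrow> G3 L CS (add_mset (Evid w t A) (add_mset (ERel w v) \<Gamma>)) \<Delta>"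
| AN: "G3 L CS (add_mset (Evid w (JConst c) A) \<Gamma>) \<Delta> \<Longrightarrow> (JConst c \<^bold>: A) \<in> CS
    \<Longrightarrow> G3 L CS \<Gamma> \<Delta>"
| RE: "G3 L CS (add_mset (ERel w v) (add_mset (Rel w v) \<Gamma>)) \<Delta>
    \<Longrightarrow> G3 L CS (add_mset (Rel w v) \<Gamma>) \<Delta>"
| RefE: "G3 L CS (add_mset (ERel w w) \<Gamma>) \<Delta> \<Longrightarrow> G3 L CS \<Gamma> \<Delta>"
| SymE: "L = S4LPN \<Longrightarrow> G3 L CS (add_mset (ERel v w) (add_mset (ERel w v) \<Gamma>)) \<Delta>
    \<Longrightarrow> G3 L CS (add_mset (ERel w v) \<Gamma>) \<Delta>"
| TransE: "G3 L CS (add_mset (ERel w u) (add_mset (ERel w v) (add_mset (ERel v u) \<Gamma>))) \<Delta>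
    \<Longrightarrow> G3 L CS (add_mset (ERel w v) (add_mset (ERel v u) \<Gamma>)) \<Delta>"


subsection \<open>Recursive functions and decidability\<close>

text \<open>\<open>recursive n f\<close>: the restriction of \<open>f\<close> to lists of length \<open>n\<close> is a (total) general
  recursive function of arity \<open>n\<close>.  Minimization is applied to regular functions only, which
  still yields all total computable functions.  The values of \<open>f\<close> on lists of any
  other length are irrelevant.\<close>

inductive recursive :: "nat \<Rightarrow> (nat list \<Rightarrow> nat) \<Rightarrow> bool" where
  zero: "recursive n (\<lambda>xs. 0)"
| succ: "recursive 1 (\<lambda>xs. Suc (xs ! 0))"
| proj: "i < n \<Longrightarrow> recursive n (\<lambda>xs. xs ! i)"
| comp: "recursive (length fs) g \<Longrightarrow> (\<forall>f\<in>set fs. recursive n f)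
    \<Longrightarrow> recursive n (\<lambda>xs. g (map (\<lambda>f. f xs) fs))"
| prim_rec: "recursive n g \<Longrightarrow> recursive (Suc (Suc n)) h
    \<Longrightarrow> recursive (Suc n) (\<lambda>xs. rec_nat (g (tl xs)) (\<lambda>k r. h (k # r # tl xs)) (hd xs))"
| minimize: "recursive (Suc n) g \<Longrightarrow> (\<forall>xs. length xs = n \<longrightarrow> (\<exists>y. g (y # xs) = 0))
    \<Longrightarrow> recursive n (\<lambda>xs. LEAST y. g (y # xs) = 0)"

text \<open>The decision problem with set of instances \<open>I\<close> (presented to the algorithm via the coding
  \<open>code\<close>) and question \<open>P\<close> is decidable; nothing is required on numbers not coding an
  instance.\<close>

definition decidable_problem :: "('a \<Rightarrow> nat) \<Rightarrow> 'a set \<Rightarrow> ('a \<Rightarrow> bool) \<Rightarrow> bool" where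
  "decidable_problem code I P \<longleftrightarrow>
     (\<exists>f. recursive 1 f \<and> (\<forall>x\<in>I. f [code x] = (if P x then 1 else 0)))"


subsection \<open>Coding of the syntax\<close>

fun tm_code :: "tm \<Rightarrow> nat" where
  "tm_code (JVar n) = prod_encode (0, n)"
| "tm_code (JConst n) = prod_encode (1, n)"
| "tm_code (s \<^bold>\<cdot> t) = prod_encode (2, prod_encode (tm_code s, tm_code t))"
| "tm_code (s \<^bold>+ t) = prod_encode (3, prod_encode (tm_code s, tm_code t))"
| "tm_code (\<^bold>! t) = prod_encode (4, tm_code t)"

fun fm_code :: "fm \<Rightarrow> nat" where
  "fm_code (PVar n) = prod_encode (0, n)"
| "fm_code \<^bold>\<bottom> = prod_encode (1, 0)"
| "fm_code (\<^bold>\<not> A) = prod_encode (2, fm_code A)"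
| "fm_code (A \<^bold>\<and> B) = prod_encode (3, prod_encode (fm_code A, fm_code B))"
| "fm_code (A \<^bold>\<or> B) = prod_encode (4, prod_encode (fm_code A, fm_code B))"
| "fm_code (A \<^bold>\<rightarrow> B) = prod_encode (5, prod_encode (fm_code A, fm_code B))"
| "fm_code (t \<^bold>: A) = prod_encode (6, prod_encode (tm_code t, fm_code A))"
| "fm_code (\<^bold>\<box> A) = prod_encode (7, fm_code A)"

fun item_code :: "item \<Rightarrow> nat" where
  "item_code (w \<^bold>\<tturnstile> A) = prod_encode (0, prod_encode (w, fm_code A))"
| "item_code (Rel w v) = prod_encode (1, prod_encode (w, v))"
| "item_code (ERel w v) = prod_encode (2, prod_encode (w, v))"
| "item_code (Evid w t A) =
     prod_encode (3, prod_encode (w, prod_encode (tm_code t, fm_code A)))"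

text \<open>An input consists of a finite constant specification and a sequent; the finite set and the
  two finite multisets are given by listing their elements in any order.\<close>

fun input_code :: "fm list \<times> item list \<times> item list \<Rightarrow> nat" where
  "input_code (cs, \<Gamma>, \<Delta>) =
     prod_encode (list_encode (map fm_code cs),
       prod_encode (list_encode (map item_code \<Gamma>), list_encode (map item_code \<Delta>)))"

lemma tm_code_inject [simp]: "tm_code s = tm_code t \<longleftrightarrow> s = t"
proof (induction s arbitrary: t)
  case (JVar n) show ?case by (cases t) auto
next
  case (JConst n) show ?case by (cases t) auto
next
  case (App s1 s2) then show ?case by (cases t) auto
next
  case (Sum s1 s2) then show ?case by (cases t) auto
next
  case (Bang s) then show ?case by (cases t) auto
qed

lemma fm_code_inject [simp]: "fm_code A = fm_code B \<longleftrightarrow> A = B"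
proof (induction A arbitrary: B)
  case (PVar n) show ?case by (cases B) auto
next
  case Falsum show ?case by (cases B) auto
next
  case (Neg A) then show ?case by (cases B) auto
next
  case (Con A1 A2) then show ?case by (cases B) auto
next
  case (Dis A1 A2) then show ?case by (cases B) auto
next
  case (Imp A1 A2) then show ?case by (cases B) auto
next
  case (Just t A) then show ?case by (cases B) auto
next
  case (Box A) then show ?case by (cases B) auto
qed

lemma item_code_inject [simp]: "item_code x = item_code y \<longleftrightarrow> x = y"
  by (cases x; cases y) auto

lemma inj_input_code: "inj input_code"
  by (rule injI) (auto simp: inj_map_eq_map inj_def list_encode_eq)

end

theory Submission
  imports Defs
begin

text \<open>A sequent is derivable iff it is valid in the (finite) Fitting models of the logic.  If it is
  underivable, a fair root-first proof search yields a saturated pair of sets of items.  Identify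
  labels that agree on all formulas and evidence facts with codes below the code \<open>x\<close> of the input,
  and on which input labels see them.  The resulting types carry enough information to define both
  accessibility relations by preservation of facts, which makes the quotient a countermodel: it is reflexive and
  transitive by construction, and it reflects the relational atoms between input labels because each
  type records the input labels seeing it.  Such a countermodel is a set of sets of numbers
  polynomial in \<open>x\<close>, hence has a code below a double exponential in \<open>x\<close>, and being a
  countermodel is expressed by bounded quantifiers over recursive relations.\<close>

subsection \<open>Recursive functions and relations\<close>

text \<open>Exhaustive root-first search need not terminate: (El+) and (Er+) bring in arbitrary
  terms, (E!) builds ever larger formulas, and transitive relations keep demanding fresh labels. The
  limit of the search is therefore used only as an existence argument, and the algorithm looks for a
  countermodel rather than a derivation.

  The cut is made by code size instead of by subformulas. Pairing dominates its arguments, so the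
  codes up to the input code contain every item of the input and are closed under subterms and
  subformulas, and a single number serves as the bound everywhere. The price is that this range is
  not closed under the evidence operations: a world stores only a fragment of its evidence, the
  model regenerates the rest, and it must be shown that nothing new appears inside the range.

  Worlds are partial. They list true and false formulas separately and may leave a formula
  undecided, so no maximal consistent sets are formed and the truth lemma is a pair of one-way
  implications.\<close>

definition computable :: "nat \<Rightarrow> (nat list \<Rightarrow> nat) \<Rightarrow> bool" where
  "computable n f \<longleftrightarrow> (\<exists>g. recursive n g \<and> (\<forall>e. length e = n \<longrightarrow> f e = g e))"

definition decidable_rel :: "nat \<Rightarrow> (nat list \<Rightarrow> bool) \<Rightarrow> bool" where
  "decidable_rel n P \<longleftrightarrow> computable n (\<lambda>e. of_bool (P e))"

lemma computableI: "recursive n g \<Longrightarrow> (\<And>e. length e = n \<Longrightarrow> f e = g e) \<Longrightarrow> computable n f"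
  unfolding computable_def by blast

text \<open>This is the gain over \<open>recursive\<close>, whose rules fix the shape of a function
  and its values on lists of every length. Only the values on lists of length n matter here, so
  extensionally equal descriptions can be exchanged.\<close>

lemma computable_cong:
  "computable n f \<Longrightarrow> (\<And>e. length e = n \<Longrightarrow> f e = g e) \<Longrightarrow> computable n g"
  unfolding computable_def by metis

lemma computable_comp:
  assumes g: "computable (length fs) g" and fs: "\<forall>f\<in>set fs. computable n f"
  shows "computable n (\<lambda>e. g (map (\<lambda>f. f e) fs))"
proof -
  obtain g' where g': "recursive (length fs) g'" "\<And>e. length e = length fs \<Longrightarrow> g e = g' e"
    using g unfolding computable_def by blast
  obtain r where r: "\<And>f. f \<in> set fs \<Longrightarrow> recursive n (r f)"
      "\<And>f e. f \<in> set fs \<Longrightarrow> length e = n \<Longrightarrow> f e = r f e"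
    using fs unfolding computable_def by metis
  have "recursive n (\<lambda>e. g' (map (\<lambda>f. f e) (map r fs)))"
    by (rule recursive.comp) (auto simp: g' r)
  moreover have "g (map (\<lambda>f. f e) fs) = g' (map (\<lambda>f. f e) (map r fs))" if "length e = n" for e
  proof -
    have "map (\<lambda>f. f e) fs = map (\<lambda>f. f e) (map r fs)" using r(2) that by simp
    then show ?thesis by (metis g'(2) length_map)
  qed
  ultimately show ?thesis by (rule computableI)
qed

lemma computable_prim_rec:
  assumes "computable n g" "computable (Suc (Suc n)) h"
  shows "computable (Suc n) (\<lambda>e. rec_nat (g (tl e)) (\<lambda>k r. h (k # r # tl e)) (hd e))"
proof -
  obtain g' h' where *: "recursive n g'" "\<And>e. length e = n \<Longrightarrow> g e = g' e"
      "recursive (Suc (Suc n)) h'" "\<And>e. length e = Suc (Suc n) \<Longrightarrow> h e = h' e"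
    using assms unfolding computable_def by metis
  show ?thesis
  proof (rule computableI[OF recursive.prim_rec[OF *(1,3)]])
    fix e :: "nat list" assume "length e = Suc n"
    then have l: "length (tl e) = n" by simp
    show "rec_nat (g (tl e)) (\<lambda>k r. h (k # r # tl e)) (hd e)
        = rec_nat (g' (tl e)) (\<lambda>k r. h' (k # r # tl e)) (hd e)"
      using l by (simp add: *(2,4))
  qed
qed

lemma computable_nth: "i < n \<Longrightarrow> computable n (\<lambda>e. e ! i)"
  by (rule computableI[OF recursive.proj]) auto

lemma computable_hd: "computable (Suc n) hd"
  by (rule computable_cong[OF computable_nth[of 0]]) (auto simp: hd_conv_nth[symmetric] length_Suc_conv)

text \<open>Lists act as environments with the innermost variable at the head, so this lemma passes
  under one binder. Iterated from \<open>computable_hd\<close> it gives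
  \<open>computable_projections\<close>; ten variables cover the deepest quantifier nesting in
  \<open>refutable\<close>.\<close>

lemma computable_weaken:
  assumes "computable n f"
  shows "computable (Suc n) (\<lambda>e. f (tl e))"
proof -
  have "computable (Suc n) (\<lambda>e. f (map (\<lambda>f. f e) (map (\<lambda>i e. e ! Suc i) [0..<n])))"
    by (rule computable_comp) (auto simp: assms computable_nth)
  then show ?thesis
  proof (rule computable_cong)
    fix e :: "nat list" assume "length e = Suc n"
    then have "map (\<lambda>f. f e) (map (\<lambda>i e. e ! Suc i) [0..<n]) = tl e"
      by (auto intro!: nth_equalityI simp: nth_tl)
    then show "f (map (\<lambda>f. f e) (map (\<lambda>i e. e ! Suc i) [0..<n])) = f (tl e)" by simp
  qed
qed

named_theorems computable_intros

lemmas computable_tl1 = computable_hd[THEN computable_weaken]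
lemmas computable_tl2 = computable_tl1[THEN computable_weaken]
lemmas computable_tl3 = computable_tl2[THEN computable_weaken]
lemmas computable_tl4 = computable_tl3[THEN computable_weaken]
lemmas computable_tl5 = computable_tl4[THEN computable_weaken]
lemmas computable_tl6 = computable_tl5[THEN computable_weaken]
lemmas computable_tl7 = computable_tl6[THEN computable_weaken]
lemmas computable_tl8 = computable_tl7[THEN computable_weaken]
lemmas computable_tl9 = computable_tl8[THEN computable_weaken]
lemmas computable_projections [computable_intros] = computable_hd computable_tl1 computable_tl2 computable_tl3 computable_tl4 computable_tl5 computable_tl6 computable_tl7 computable_tl8 computable_tl9

text \<open>Substitution: it is enough to treat F applied to variables. Each definition can thus be
  unfolded in an environment of its own arguments only, however deeply it is used later.\<close>

lemma computable_lift1: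
  assumes "computable (Suc 0) (\<lambda>e. F (hd e))" "computable n f"
  shows "computable n (\<lambda>e. F (f e))"
  using computable_comp[of "[f]" "\<lambda>e. F (hd e)" n] assms by simp

lemma computable_lift2:
  assumes "computable (Suc (Suc 0)) (\<lambda>e. F (hd e) (hd (tl e)))" "computable n f" "computable n g"
  shows "computable n (\<lambda>e. F (f e) (g e))"
  using computable_comp[of "[f, g]" "\<lambda>e. F (hd e) (hd (tl e))" n] assms by simp

lemma computable_lift3:
  assumes "computable (Suc (Suc (Suc 0))) (\<lambda>e. F (hd e) (hd (tl e)) (hd (tl (tl e))))"
    "computable n f" "computable n g" "computable n h"
  shows "computable n (\<lambda>e. F (f e) (g e) (h e))"
  using computable_comp[of "[f, g, h]" "\<lambda>e. F (hd e) (hd (tl e)) (hd (tl (tl e)))" n] assms by simp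

lemmas decidable_rel_lift2 = computable_lift2[where F = "\<lambda>a b. of_bool (P a b)" for P,
    folded decidable_rel_def]
lemmas decidable_rel_lift3 = computable_lift3[where F = "\<lambda>a b c. of_bool (P a b c)" for P,
    folded decidable_rel_def]

section \<open>Arithmetic functions\<close>

lemma computable_Suc [computable_intros]:
  assumes "computable n f"
  shows "computable n (\<lambda>e. Suc (f e))"
proof -
  have "computable (Suc 0) (\<lambda>e. Suc (hd e))"
    by (rule computableI[OF recursive.succ[unfolded One_nat_def]]) (auto simp: hd_conv_nth length_Suc_conv)
  from computable_lift1[OF this assms] show ?thesis .
qed

lemma computable_const: "computable n (\<lambda>e. c)"
  by (induction c) (auto intro: computableI recursive.zero computable_Suc)

lemma computable_numerals [computable_intros]:
  "computable n (\<lambda>e. 0)" "computable n (\<lambda>e. Suc 0)" "computable n (\<lambda>e. 1)" "computable n (\<lambda>e. numeral k)"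
  by (rule computable_const)+

lemma computable_plus [computable_intros]:
  assumes "computable n f" "computable n g"
  shows "computable n (\<lambda>e. f e + g e)"
proof (rule computable_lift2[where F = "(+)", OF _ assms])
  have "computable (Suc (Suc 0)) (\<lambda>e. rec_nat (hd (tl e)) (\<lambda>k r. Suc (hd (tl (k # r # tl e)))) (hd e))"
    by (rule computable_prim_rec) (intro computable_intros)+
  moreover have "rec_nat b (\<lambda>k r. Suc r) a = a + b" for a b :: nat by (induction a) auto
  ultimately show "computable (Suc (Suc 0)) (\<lambda>e. hd e + hd (tl e))" by simp
qed

lemma computable_times [computable_intros]:
  assumes "computable n f" "computable n g"
  shows "computable n (\<lambda>e. f e * g e)"
proof (rule computable_lift2[where F = "(*)", OF _ assms])
  have "computable (Suc (Suc 0)) (\<lambda>e. rec_nat 0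
      (\<lambda>k r. hd (tl (k # r # tl e)) + hd (tl (tl (k # r # tl e)))) (hd e))"
    by (rule computable_prim_rec) (intro computable_intros)+
  moreover have "rec_nat 0 (\<lambda>k r. r + b) a = a * b" for a b :: nat by (induction a) auto
  ultimately show "computable (Suc (Suc 0)) (\<lambda>e. hd e * hd (tl e))" by simp
qed

lemma computable_power2 [computable_intros]:
  assumes "computable n f"
  shows "computable n (\<lambda>e. 2 ^ f e)"
proof (rule computable_lift1[where F = "(^) 2", OF _ assms])
  have "computable (Suc 0) (\<lambda>e. rec_nat (Suc 0) (\<lambda>k r. 2 * hd (tl (k # r # tl e))) (hd e))"
    by (rule computable_prim_rec) (intro computable_intros)+
  moreover have "rec_nat (Suc 0) (\<lambda>k r. 2 * r) a = (2 :: nat) ^ a" for a :: nat by (induction a) auto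
  ultimately show "computable (Suc 0) (\<lambda>e. 2 ^ hd e)" by simp
qed

lemma computable_minus [computable_intros]:
  assumes "computable n f" "computable n g"
  shows "computable n (\<lambda>e. f e - g e)"
proof -
  have "computable (Suc 0) (\<lambda>e. rec_nat 0 (\<lambda>k r. hd (k # r # tl e)) (hd e))"
    by (rule computable_prim_rec) (intro computable_intros)+
  moreover have "rec_nat 0 (\<lambda>k r. k) a = a - 1" for a :: nat by (cases a) auto
  ultimately have pred: "computable (Suc 0) (\<lambda>e. hd e - 1)" by simp
  \<comment> \<open>Recursion runs over the head of the list, so the subtrahend has to come first;
    the order of the arguments is restored in the last step.\<close>
  have "computable (Suc (Suc 0)) (\<lambda>e. rec_nat (hd (tl e)) (\<lambda>k r. hd (tl (k # r # tl e)) - 1) (hd e))"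
    by (rule computable_prim_rec) (intro computable_intros computable_lift1[OF pred])+
  moreover have "rec_nat b (\<lambda>k r. r - 1) a = b - a" for a b :: nat by (induction a) auto
  ultimately have "computable (Suc (Suc 0)) (\<lambda>e. hd (tl e) - hd e)" by simp
  from computable_lift2[OF this assms(2,1)] show ?thesis .
qed

section \<open>Closure of decidable relations under connectives and bounded quantifiers\<close>

lemma decidable_rel_const [computable_intros]: "decidable_rel n (\<lambda>e. Q)"
  unfolding decidable_rel_def by (rule computable_const)

lemma decidable_rel_le [computable_intros]:
  assumes "computable n f" "computable n g"
  shows "decidable_rel n (\<lambda>e. f e \<le> g e)"
proof -
  have "computable n (\<lambda>e. 1 - (f e - g e))" by (intro computable_intros assms)
  then show ?thesis unfolding decidable_rel_def by (rule computable_cong) auto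
qed

lemma decidable_rel_not [computable_intros]:
  assumes "decidable_rel n P"
  shows "decidable_rel n (\<lambda>e. \<not> P e)"
proof -
  have "computable n (\<lambda>e. 1 - of_bool (P e))"
    by (intro computable_intros assms[unfolded decidable_rel_def])
  then show ?thesis unfolding decidable_rel_def by (rule computable_cong) auto
qed

lemma decidable_rel_conj [computable_intros]:
  assumes "decidable_rel n P" "decidable_rel n Q"
  shows "decidable_rel n (\<lambda>e. P e \<and> Q e)"
proof -
  have "computable n (\<lambda>e. of_bool (P e) * of_bool (Q e))"
    by (intro computable_intros assms[unfolded decidable_rel_def])
  then show ?thesis unfolding decidable_rel_def by (rule computable_cong) auto
qed

lemma decidable_rel_disj [computable_intros]:
  assumes "decidable_rel n P" "decidable_rel n Q"
  shows "decidable_rel n (\<lambda>e. P e \<or> Q e)"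
proof -
  have "decidable_rel n (\<lambda>e. \<not> (\<not> P e \<and> \<not> Q e))" by (intro computable_intros assms)
  then show ?thesis by simp
qed

lemma decidable_rel_imp [computable_intros]:
  assumes "decidable_rel n P" "decidable_rel n Q"
  shows "decidable_rel n (\<lambda>e. P e \<longrightarrow> Q e)"
proof -
  have "decidable_rel n (\<lambda>e. \<not> P e \<or> Q e)" by (intro computable_intros assms)
  then show ?thesis by (simp only: imp_conv_disj)
qed

lemma decidable_rel_eq [computable_intros]:
  assumes "computable n f" "computable n g"
  shows "decidable_rel n (\<lambda>e. f e = g e)"
proof -
  have "decidable_rel n (\<lambda>e. f e \<le> g e \<and> g e \<le> f e)" by (intro computable_intros assms)
  then show ?thesis by (simp add: eq_iff)
qed

lemma decidable_rel_less [computable_intros]: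
  assumes "computable n f" "computable n g"
  shows "decidable_rel n (\<lambda>e. f e < g e)"
proof -
  have "decidable_rel n (\<lambda>e. Suc (f e) \<le> g e)" by (intro computable_intros assms)
  then show ?thesis by (simp add: Suc_le_eq)
qed

lemma decidable_rel_ex_less [computable_intros]:
  assumes P: "decidable_rel (Suc n) (\<lambda>e. P (hd e) (tl e))" and f: "computable n f"
  shows "decidable_rel n (\<lambda>e. \<exists>k<f e. P k e)"
proof -
  \<comment> \<open>The sign function: 1 - (1 - n) is 0 for n = 0 and 1 otherwise. The accumulator r
    thus carries the disjunction of P over all smaller k.\<close>
  define h :: "nat list \<Rightarrow> nat" where
    "h e = 1 - (1 - (hd (tl e) + of_bool (P (hd e) (tl (tl e)))))" for e
  have "computable (Suc (Suc n)) (\<lambda>e. of_bool (P (hd e) (tl (tl e))))"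
  proof -
    \<comment> \<open>Deletes the accumulator, the second entry of the list, which P must not
      see.\<close>
    define fs :: "(nat list \<Rightarrow> nat) list" where "fs = (\<lambda>e. hd e) # map (\<lambda>i e. e ! Suc (Suc i)) [0..<n]"
    have "computable (Suc (Suc n)) (\<lambda>e. of_bool (P (hd (map (\<lambda>f. f e) fs)) (tl (map (\<lambda>f. f e) fs))))"
      using computable_comp[of fs "\<lambda>e. of_bool (P (hd e) (tl e))" "Suc (Suc n)"] P
      by (auto simp: fs_def decidable_rel_def computable_nth computable_hd)
    then show ?thesis
    proof (rule computable_cong)
      fix e :: "nat list" assume "length e = Suc (Suc n)"
      then have "map (\<lambda>f. f e) fs = hd e # tl (tl e)"
        by (auto intro!: nth_equalityI simp: nth_tl fs_def)
      then show "of_bool (P (hd (map (\<lambda>f. f e) fs)) (tl (map (\<lambda>f. f e) fs)))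
          = of_bool (P (hd e) (tl (tl e)))" by simp
    qed
  qed
  then have "computable (Suc (Suc n)) h"
    unfolding h_def by (intro computable_intros)
  then have rec: "computable (Suc n) (\<lambda>e. rec_nat 0 (\<lambda>k r. h (k # r # tl e)) (hd e))"
    by (rule computable_prim_rec[rotated]) (intro computable_intros)
  have eq: "rec_nat 0 (\<lambda>k r. h (k # r # e)) m = of_bool (\<exists>k<m. P k e)" for m e
    by (induction m) (auto simp: h_def less_Suc_eq)
  have "computable n (\<lambda>e. of_bool (\<exists>k<f e. P k e))"
  proof -
    define fs :: "(nat list \<Rightarrow> nat) list" where "fs = f # map (\<lambda>i e. e ! i) [0..<n]"
    have "computable n (\<lambda>e. of_bool (\<exists>k<hd (map (\<lambda>f. f e) fs). P k (tl (map (\<lambda>f. f e) fs))))"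
      using computable_comp[of fs "\<lambda>e. rec_nat 0 (\<lambda>k r. h (k # r # tl e)) (hd e)" n] rec f
      by (auto simp: fs_def computable_nth eq)
    then show ?thesis
    proof (rule computable_cong)
      fix e :: "nat list" assume "length e = n"
      then have "map (\<lambda>f. f e) fs = f e # e"
        by (auto intro!: nth_equalityI simp: nth_tl fs_def map_nth)
      then show "of_bool (\<exists>k<hd (map (\<lambda>f. f e) fs). P k (tl (map (\<lambda>f. f e) fs)))
          = of_bool (\<exists>k<f e. P k e)" by simp
    qed
  qed
  then show ?thesis unfolding decidable_rel_def .
qed

lemma decidable_rel_ex_le [computable_intros]:
  assumes "decidable_rel (Suc n) (\<lambda>e. P (hd e) (tl e))" "computable n f"
  shows "decidable_rel n (\<lambda>e. \<exists>k\<le>f e. P k e)"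
proof -
  have "decidable_rel n (\<lambda>e. \<exists>k<Suc (f e). P k e)" by (intro computable_intros assms)
  then show ?thesis by (simp add: less_Suc_eq_le)
qed

lemma decidable_rel_all_less [computable_intros]:
  assumes "decidable_rel (Suc n) (\<lambda>e. P (hd e) (tl e))" "computable n f"
  shows "decidable_rel n (\<lambda>e. \<forall>k<f e. P k e)"
proof -
  have "decidable_rel n (\<lambda>e. \<not> (\<exists>k<f e. \<not> P k e))" by (intro computable_intros assms)
  then show ?thesis by simp
qed

lemma decidable_rel_all_le [computable_intros]:
  assumes "decidable_rel (Suc n) (\<lambda>e. P (hd e) (tl e))" "computable n f"
  shows "decidable_rel n (\<lambda>e. \<forall>k\<le>f e. P k e)"
proof -
  have "decidable_rel n (\<lambda>e. \<forall>k<Suc (f e). P k e)" by (intro computable_intros assms)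
  then show ?thesis by (simp add: less_Suc_eq_le)
qed

subsection \<open>Pairs, finite sets and lists coded by numbers\<close>

definition pr :: "nat \<Rightarrow> nat \<Rightarrow> nat" where
  "pr a b = prod_encode (a, b)"

lemma pr_inject [simp]: "pr a b = pr a' b' \<longleftrightarrow> a = a' \<and> b = b'"
  by (simp add: pr_def)

lemma le_pr: "a \<le> pr a b" "b \<le> pr a b"
  unfolding pr_def by (rule le_prod_encode_1 le_prod_encode_2)+

lemma pr_le_D: "pr a b \<le> c \<Longrightarrow> a \<le> c \<and> b \<le> c"
  using le_pr order_trans by blast

lemma pr_mono: "a \<le> a' \<Longrightarrow> b \<le> b' \<Longrightarrow> pr a b \<le> pr a' b'"
  unfolding pr_def prod_encode_def prod.case triangle_def
  by (intro add_mono div_le_mono mult_le_mono) auto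

lemma computable_pr [computable_intros]:
  assumes "computable n f" "computable n g"
  shows "computable n (\<lambda>e. pr (f e) (g e))"
proof (rule computable_lift2[where F = pr, OF _ assms])
  have "computable (Suc 0) (\<lambda>e. rec_nat 0 (\<lambda>k r. hd (tl (k # r # tl e)) + Suc (hd (k # r # tl e))) (hd e))"
    by (rule computable_prim_rec) (intro computable_intros)+
  moreover have "rec_nat 0 (\<lambda>k r. r + Suc k) a = triangle a" for a :: nat by (induction a) auto
  ultimately have triangle: "computable (Suc 0) (\<lambda>e. triangle (hd e))" by simp
  show "computable (Suc (Suc 0)) (\<lambda>e. pr (hd e) (hd (tl e)))"
    unfolding pr_def prod_encode_def prod.case
    by (intro computable_plus computable_lift1[OF triangle] computable_projections)
qed

text \<open>Bit a of s is set when the quotient of s by \<open>2 ^ a\<close> is odd; q and r are the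
  half of that quotient and the remainder. This form replaces division by bounded quantifiers over
  sums, products and powers of 2, which are already known to be computable.\<close>

lemma set_decode_iff: "a \<in> set_decode s \<longleftrightarrow> (\<exists>q\<le>s. \<exists>r<2 ^ a. s = (2 * q + 1) * 2 ^ a + r)"
proof
  assume "a \<in> set_decode s"
  then have "odd (s div 2 ^ a)" by (simp add: set_decode_def)
  then obtain q where q: "s div 2 ^ a = 2 * q + 1" by (rule oddE)
  have "q \<le> s" using q div_le_dividend[of s "2 ^ a"] by linarith
  moreover have "s = (2 * q + 1) * 2 ^ a + s mod 2 ^ a" using q by (metis div_mult_mod_eq)
  moreover have "s mod 2 ^ a < 2 ^ a" by simp
  ultimately show "\<exists>q\<le>s. \<exists>r<2 ^ a. s = (2 * q + 1) * 2 ^ a + r" by blast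
next
  assume "\<exists>q\<le>s. \<exists>r<2 ^ a. s = (2 * q + 1) * 2 ^ a + r"
  then obtain q r where "r < 2 ^ a" "s = (2 * q + 1) * 2 ^ a + r" by blast
  then have "s div 2 ^ a = 2 * q + 1" by (simp only: div_mult_self3) simp
  then show "a \<in> set_decode s" by (simp add: set_decode_def)
qed

lemma decidable_rel_set_decode [computable_intros]:
  assumes "computable n f" "computable n g"
  shows "decidable_rel n (\<lambda>e. f e \<in> set_decode (g e))"
  by (rule decidable_rel_lift2[where P = "\<lambda>a s. a \<in> set_decode s", OF _ assms])
    (unfold set_decode_iff, intro computable_intros)

lemma set_encode_less:
  assumes "A \<subseteq> {..<n}"
  shows "set_encode A < 2 ^ n"
proof -
  have "set_encode A \<le> (\<Sum>k<n. 2 ^ k)"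
    unfolding set_encode_def by (rule sum_mono2) (use assms in auto)
  also have "\<dots> < 2 ^ n" by (induction n) auto
  finally show ?thesis .
qed

text \<open>Membership in a coded list, and below the property of being the code of a term, are expressed
  by quantifying over the (bounded) codes of finite sets closed under the relevant constructors, which
  avoids course-of-values recursion.\<close>

definition list_mem :: "nat \<Rightarrow> nat \<Rightarrow> bool" where
  "list_mem a l \<longleftrightarrow> (\<forall>S<2 ^ Suc l. l \<in> set_decode S \<and>
     (\<forall>h\<le>l. \<forall>t\<le>l. Suc (pr h t) \<in> set_decode S \<longrightarrow> t \<in> set_decode S) \<longrightarrow>
     (\<exists>t\<le>l. Suc (pr a t) \<in> set_decode S))"

lemma decidable_rel_list_mem [computable_intros]:
  assumes "computable n f" "computable n g"
  shows "decidable_rel n (\<lambda>e. list_mem (f e) (g e))"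
  by (rule decidable_rel_lift2[where P = list_mem, OF _ assms])
    (unfold list_mem_def, intro computable_intros)

lemma list_encode_Cons: "list_encode (a # xs) = Suc (pr a (list_encode xs))"
  by (simp add: pr_def)

lemma le_list_encode: "a \<in> set xs \<Longrightarrow> a \<le> list_encode xs"
proof (induction xs)
  case (Cons x xs)
  then show ?case
    using le_pr[where a = x and b = "list_encode xs"]
    by (auto simp: list_encode_Cons simp del: list_encode.simps)
qed simp

lemma list_encode_append_le: "list_encode ys \<le> list_encode (xs @ ys)"
proof (induction xs)
  case (Cons x xs)
  then show ?case
    using le_pr(2)[of "list_encode (xs @ ys)" x] by (simp add: list_encode_Cons del: list_encode.simps)
qed simp

lemma list_mem_list_encode: "list_mem a (list_encode xs) \<longleftrightarrow> a \<in> set xs"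
proof
  let ?l = "list_encode xs"
  \<comment> \<open>The codes of the suffixes of xs form the least set that contains the code of xs
    and is closed under tails. They are at most \<open>?l\<close>, so the code of B lies below the
    bound \<open>2 ^ Suc ?l\<close> on S.\<close>
  define B where "B = {list_encode ys | ys. \<exists>zs. xs = zs @ ys}"
  assume mem: "list_mem a ?l"
  have B: "B \<subseteq> {..<Suc ?l}" by (auto simp: B_def list_encode_append_le less_Suc_eq_le)
  then have dec: "set_decode (set_encode B) = B"
    by (intro set_encode_inverse) (rule finite_subset, auto)
  have tail: "t \<in> B \<and> h \<in> set xs" if tB: "Suc (pr h t) \<in> B" for h t
  proof -
    obtain ys zs where ys: "Suc (pr h t) = list_encode ys" "xs = zs @ ys"
      using tB unfolding B_def by blast
    then obtain y ys' where "ys = y # ys'" by (cases ys) auto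
    then have "h = y" "t = list_encode ys'" "xs = (zs @ [y]) @ ys'"
      using ys by (auto simp: list_encode_Cons simp del: list_encode.simps)
    then show ?thesis unfolding B_def by auto
  qed
  have "?l \<in> B" unfolding B_def by (auto intro: exI[of _ xs])
  moreover have "\<forall>h\<le>?l. \<forall>t\<le>?l. Suc (pr h t) \<in> B \<longrightarrow> t \<in> B" using tail by blast
  ultimately obtain t where "Suc (pr a t) \<in> B"
    using mem[unfolded list_mem_def, rule_format, OF set_encode_less[OF B]] unfolding dec by blast
  then show "a \<in> set xs" using tail by blast
next
  let ?l = "list_encode xs"
  assume "a \<in> set xs"
  then obtain ys zs where xs: "xs = ys @ a # zs" by (metis split_list)
  show "list_mem a ?l" unfolding list_mem_def
  proof (intro allI impI)
    fix S assume S: "?l \<in> set_decode S \<and>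
      (\<forall>h\<le>?l. \<forall>t\<le>?l. Suc (pr h t) \<in> set_decode S \<longrightarrow> t \<in> set_decode S)"
    \<comment> \<open>A closed S contains every suffix code. The induction lengthens the removed
      prefix at its right end, so that the induction hypothesis speaks about the suffix that is
      longer by one.\<close>
    have "list_encode vs \<in> set_decode S" if "xs = us @ vs" for us vs
      using that
    proof (induction us arbitrary: vs rule: rev_induct)
      case Nil then show ?case using S by simp
    next
      case (snoc u us)
      have "Suc (pr u (list_encode vs)) \<in> set_decode S"
        using snoc.IH[of "u # vs"] snoc.prems by (simp add: list_encode_Cons del: list_encode.simps)
      moreover have "u \<le> ?l" using snoc.prems by (intro le_list_encode) auto
      moreover have "list_encode vs \<le> ?l" using snoc.prems list_encode_append_le by metis
      ultimately show ?case using S by blast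
    qed
    then have "Suc (pr a (list_encode zs)) \<in> set_decode S"
      using xs list_encode_Cons by metis
    moreover have "list_encode zs \<le> ?l"
      unfolding xs using list_encode_append_le[of zs "ys @ [a]"] by simp
    ultimately show "\<exists>t\<le>?l. Suc (pr a t) \<in> set_decode S" by blast
  qed
qed

subsection \<open>Models and soundness\<close>

text \<open>The least evidence function over a base B. Generating it makes the rules for
  application, sum and \<open>!\<close> sound by construction, and lets a finite base stand for
  evidence about infinitely many terms.\<close>

inductive evidence :: "(tm \<Rightarrow> fm \<Rightarrow> bool) \<Rightarrow> tm \<Rightarrow> fm \<Rightarrow> bool" for B where
  base: "B t A \<Longrightarrow> evidence B t A"
| app: "evidence B s (A \<^bold>\<rightarrow> C) \<Longrightarrow> evidence B t A \<Longrightarrow> evidence B (s \<^bold>\<cdot> t) C"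
| suml: "evidence B t A \<Longrightarrow> evidence B (s \<^bold>+ t) A"
| sumr: "evidence B t A \<Longrightarrow> evidence B (t \<^bold>+ s) A"
| bang: "evidence B t A \<Longrightarrow> evidence B (\<^bold>! t) (t \<^bold>: A)"

lemma evidence_mono: "evidence B t A \<Longrightarrow> (\<And>t A. B t A \<Longrightarrow> C t A) \<Longrightarrow> evidence C t A"
  by (induction rule: evidence.induct) (auto intro: evidence.intros)

text \<open>Fitting models with a second relation Re for the justification modality. Reflexivity of
  Re on W follows from \<open>R_refl\<close> and \<open>R_Re\<close>. Symmetry of Re is what makes
  the absence of \<open>t : A\<close> persist along R: evidence and Re-successors of an R-successor
  can be carried back.\<close>

locale fitting_model =
  fixes L :: logic and CS :: "fm set" and W :: "'w set"
    and R Re :: "'w \<Rightarrow> 'w \<Rightarrow> bool" and B :: "'w \<Rightarrow> tm \<Rightarrow> fm \<Rightarrow> bool" and V :: "'w \<Rightarrow> nat \<Rightarrow> bool"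
  assumes R_refl: "w \<in> W \<Longrightarrow> R w w"
    and R_trans: "R w v \<Longrightarrow> R v u \<Longrightarrow> R w u"
    and R_Re: "R w v \<Longrightarrow> Re w v"
    and Re_trans: "Re w v \<Longrightarrow> Re v u \<Longrightarrow> Re w u"
    and Re_sym: "L = S4LPN \<Longrightarrow> Re w v \<Longrightarrow> Re v w"
    and B_mono: "Re w v \<Longrightarrow> B w t A \<Longrightarrow> B v t A"
    and B_CS: "w \<in> W \<Longrightarrow> JConst c \<^bold>: A \<in> CS \<Longrightarrow> B w (JConst c) A"
begin

fun holds :: "'w \<Rightarrow> fm \<Rightarrow> bool" where
  "holds w (PVar p) \<longleftrightarrow> V w p"
| "holds w \<^bold>\<bottom> \<longleftrightarrow> False"
| "holds w (\<^bold>\<not> A) \<longleftrightarrow> \<not> holds w A"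
| "holds w (A \<^bold>\<and> C) \<longleftrightarrow> holds w A \<and> holds w C"
| "holds w (A \<^bold>\<or> C) \<longleftrightarrow> holds w A \<or> holds w C"
| "holds w (A \<^bold>\<rightarrow> C) \<longleftrightarrow> (holds w A \<longrightarrow> holds w C)"
| "holds w (t \<^bold>: A) \<longleftrightarrow> evidence (B w) t A \<and> (\<forall>v\<in>W. Re w v \<longrightarrow> holds v A)"
| "holds w (\<^bold>\<box> A) \<longleftrightarrow> (\<forall>v\<in>W. R w v \<longrightarrow> holds v A)"

fun sat :: "(label \<Rightarrow> 'w) \<Rightarrow> item \<Rightarrow> bool" where
  "sat \<rho> (w \<^bold>\<tturnstile> A) \<longleftrightarrow> holds (\<rho> w) A"
| "sat \<rho> (Rel w v) \<longleftrightarrow> R (\<rho> w) (\<rho> v)"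
| "sat \<rho> (ERel w v) \<longleftrightarrow> Re (\<rho> w) (\<rho> v)"
| "sat \<rho> (Evid w t A) \<longleftrightarrow> evidence (B (\<rho> w)) t A"

lemma sat_upd: "v \<notin> labels x \<Longrightarrow> sat (\<rho>(v := a)) x = sat \<rho> x"
  by (cases x) auto

lemma sat_upd_mset: "\<not> occurs v \<Gamma> \<Longrightarrow> x \<in># \<Gamma> \<Longrightarrow> sat (\<rho>(v := a)) x = sat \<rho> x"
  unfolding occurs_def using sat_upd by blast

text \<open>The two rules with a fresh label carry the argument: if the principal formula fails
  under \<open>\<rho>\<close>, the fresh label is reinterpreted as a world refuting A, and freshness
  leaves the other items unaffected (\<open>sat_upd_mset\<close>). For (Mon), monotonicity of the
  base is lifted to generated evidence by \<open>evidence_mono\<close>.\<close>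

theorem soundness:
  assumes "G3 L CS \<Gamma> \<Delta>" "\<And>w. \<rho> w \<in> W" "\<And>x. x \<in># \<Gamma> \<Longrightarrow> sat \<rho> x"
  shows "\<exists>x\<in>#\<Delta>. sat \<rho> x"
  using assms
proof (induction arbitrary: \<rho> rule: G3.induct)
  case (RBox w v \<Gamma> A \<Delta>)
  have v: "v \<noteq> w" "\<not> occurs v \<Delta>" using RBox.hyps(3) by (auto simp: occurs_def)
  show ?case
  proof (cases "holds (\<rho> w) (\<^bold>\<box> A)")
    case False
    then obtain a where a: "a \<in> W" "R (\<rho> w) a" "\<not> holds a A" by auto
    have "(\<rho>(v := a)) u \<in> W" for u using RBox.prems(1) a by simp
    then have "\<exists>x\<in>#add_mset (v \<^bold>\<tturnstile> A) \<Delta>. sat (\<rho>(v := a)) x"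
      using RBox.prems a v RBox.hyps(2) by (intro RBox.IH) (auto simp: sat_upd_mset fun_upd_same fun_upd_other simp del: fun_upd_apply)
    then show ?thesis using a v by (auto simp: sat_upd_mset fun_upd_same fun_upd_other simp del: fun_upd_apply)
  qed simp
next
  case (RJust w v t A \<Gamma> \<Delta>)
  have v: "v \<noteq> w" "\<not> occurs v \<Delta>" "\<not> occurs v \<Gamma>"
    using RJust.hyps by (auto simp: occurs_def)
  have ev: "evidence (B (\<rho> w)) t A" using RJust.prems(2)[of "Evid w t A"] by simp
  show ?case
  proof (cases "holds (\<rho> w) (t \<^bold>: A)")
    case False
    then obtain a where a: "a \<in> W" "Re (\<rho> w) a" "\<not> holds a A" using ev by auto
    have "(\<rho>(v := a)) u \<in> W" for u using RJust.prems(1) a by simp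
    then have "\<exists>x\<in>#add_mset (v \<^bold>\<tturnstile> A) \<Delta>. sat (\<rho>(v := a)) x"
      using RJust.prems a v ev by (intro RJust.IH) (auto simp: sat_upd_mset fun_upd_same fun_upd_other simp del: fun_upd_apply)
    then show ?thesis using a v by (auto simp: sat_upd_mset fun_upd_same fun_upd_other simp del: fun_upd_apply)
  qed simp
next
  case (Trans w u v \<Gamma> \<Delta>)
  then show ?case using R_trans by (metis insert_iff sat.simps(2) set_mset_add_mset_insert)
next
  case (TransE w u v \<Gamma> \<Delta>)
  then show ?case using Re_trans by (metis insert_iff sat.simps(3) set_mset_add_mset_insert)
next
  case (RE w v \<Gamma> \<Delta>)
  then show ?case using R_Re by (metis insert_iff sat.simps(2,3) set_mset_add_mset_insert)
next
  case (SymE v w \<Gamma> \<Delta>)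
  then show ?case using Re_sym by (metis insert_iff sat.simps(3) set_mset_add_mset_insert)
next
  case (MonE v t A w \<Gamma> \<Delta>)
  have "evidence (B (\<rho> v)) t A"
    using MonE.prems(2)[of "ERel w v"] MonE.prems(2)[of "Evid w t A"]
    by (auto intro: evidence_mono B_mono)
  with MonE show ?case by (intro MonE.IH) auto
next
  case (AN w c A \<Gamma> \<Delta>)
  then have "evidence (B (\<rho> w)) (JConst c) A" by (intro evidence.base B_CS) auto
  with AN show ?case by (intro AN.IH) auto
next
  case (EApp w s t C A \<Gamma> \<Delta>)
  have "evidence (B (\<rho> w)) (s \<^bold>\<cdot> t) C"
    using EApp.prems(2)[of "Evid w s (A \<^bold>\<rightarrow> C)"] EApp.prems(2)[of "Evid w t A"]
    by (auto intro: evidence.app)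
  with EApp show ?case by (intro EApp.IH) auto
next
  case (LBox v A w \<Gamma> \<Delta>)
  have "holds (\<rho> v) A" using LBox.prems(2)[of "w \<^bold>\<tturnstile> \<^bold>\<box> A"] LBox.prems(2)[of "Rel w v"] LBox.prems(1)
    by simp
  with LBox show ?case by (intro LBox.IH) auto
next
  case (LJust v A w t \<Gamma> \<Delta>)
  have "holds (\<rho> v) A" using LJust.prems(2)[of "w \<^bold>\<tturnstile> t \<^bold>: A"] LJust.prems(2)[of "ERel w v"] LJust.prems(1)
    by simp
  with LJust show ?case by (intro LJust.IH) auto
next
  case (Ref w \<Gamma> \<Delta>)
  have "R (\<rho> w) (\<rho> w)" using Ref.prems(1) by (rule R_refl)
  with Ref show ?case by (intro Ref.IH) auto
next
  case (RefE w \<Gamma> \<Delta>)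
  have "Re (\<rho> w) (\<rho> w)" using RefE.prems(1) by (intro R_Re R_refl)
  with RefE show ?case by (intro RefE.IH) auto
next
  case (InitP w p \<Gamma> \<Delta>)
  then show ?case by fastforce
next
  case (InitBot w \<Gamma> \<Delta>)
  then show ?case by fastforce
next
  case (InitR w v \<Gamma> \<Delta>)
  then show ?case by fastforce
next
  case (InitRE w v \<Gamma> \<Delta>)
  then show ?case by fastforce
next
  case (InitE w t A \<Gamma> \<Delta>)
  then show ?case by fastforce
next
  case (E w t A \<Gamma> \<Delta>)
  have "evidence (B (\<rho> w)) t A" using E.prems(2)[of "w \<^bold>\<tturnstile> t \<^bold>: A"] by simp
  with E show ?case by (intro E.IH) auto
next
  case (LNeg \<Gamma> w A \<Delta>)
  then show ?case by fastforce
next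
  case (RNeg w A \<Gamma> \<Delta>)
  then show ?case by fastforce
next
  case (LCon w A C \<Gamma> \<Delta>)
  then show ?case by fastforce
next
  case (RCon \<Gamma> w A \<Delta> C)
  then show ?case by fastforce
next
  case (LDis w A \<Gamma> \<Delta> C)
  have "holds (\<rho> w) A \<or> holds (\<rho> w) C" using LDis.prems(2)[of "w \<^bold>\<tturnstile> A \<^bold>\<or> C"] by simp
  then show ?case
  proof
    assume "holds (\<rho> w) A"
    then show ?thesis using LDis.prems by (intro LDis.IH(1)) auto
  next
    assume "holds (\<rho> w) C"
    then show ?thesis using LDis.prems by (intro LDis.IH(2)) auto
  qed
next
  case (RDis \<Gamma> w A C \<Delta>)
  then show ?case by fastforce
next
  case (LImp \<Gamma> w A \<Delta> C)
  have "holds (\<rho> w) A \<longrightarrow> holds (\<rho> w) C" using LImp.prems(2)[of "w \<^bold>\<tturnstile> A \<^bold>\<rightarrow> C"] by simp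
  then show ?case
  proof (cases "holds (\<rho> w) C")
    case True
    then show ?thesis using LImp.prems by (intro LImp.IH(2)) auto
  next
    case False
    with \<open>holds (\<rho> w) A \<longrightarrow> holds (\<rho> w) C\<close> show ?thesis
      using LImp.IH(1)[of \<rho>] LImp.prems by auto
  qed
next
  case (RImp w A \<Gamma> C \<Delta>)
  show ?case
  proof (cases "holds (\<rho> w) A")
    case True
    then have "\<exists>x\<in>#add_mset (w \<^bold>\<tturnstile> C) \<Delta>. sat \<rho> x" using RImp.prems by (intro RImp.IH) auto
    then show ?thesis by auto
  qed simp
next
  case (ElSum w s t A \<Gamma> \<Delta>)
  have "evidence (B (\<rho> w)) (s \<^bold>+ t) A"
    using ElSum.prems(2)[of "Evid w t A"] by (auto intro: evidence.suml)
  with ElSum show ?case by (intro ElSum.IH) auto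
next
  case (ErSum w t s A \<Gamma> \<Delta>)
  have "evidence (B (\<rho> w)) (t \<^bold>+ s) A"
    using ErSum.prems(2)[of "Evid w t A"] by (auto intro: evidence.sumr)
  with ErSum show ?case by (intro ErSum.IH) auto
next
  case (EBang w t A \<Gamma> \<Delta>)
  have "evidence (B (\<rho> w)) (\<^bold>! t) (t \<^bold>: A)"
    using EBang.prems(2)[of "Evid w t A"] by (auto intro: evidence.bang)
  with EBang show ?case by (intro EBang.IH) auto
qed

end

subsection \<open>Saturation of underivable sequents\<close>

text \<open>Collects the rules that keep their whole conclusion and merely add one antecedent item
  y, given the items P. The search treats them uniformly as closure conditions; only rules that
  consume their principal formula need separate treatment.\<close>

inductive adds :: "logic \<Rightarrow> fm set \<Rightarrow> item set \<Rightarrow> item \<Rightarrow> bool" for L CS where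
  Ref: "adds L CS {} (Rel w w)"
| Trans: "adds L CS {Rel w v, Rel v u} (Rel w u)"
| Box: "adds L CS {w \<^bold>\<tturnstile> \<^bold>\<box> A, Rel w v} (v \<^bold>\<tturnstile> A)"
| Just: "adds L CS {w \<^bold>\<tturnstile> t \<^bold>: A, ERel w v} (v \<^bold>\<tturnstile> A)"
| E: "adds L CS {w \<^bold>\<tturnstile> t \<^bold>: A} (Evid w t A)"
| App: "adds L CS {Evid w s (A \<^bold>\<rightarrow> B), Evid w t A} (Evid w (s \<^bold>\<cdot> t) B)"
| SumL: "adds L CS {Evid w t A} (Evid w (s \<^bold>+ t) A)"
| SumR: "adds L CS {Evid w t A} (Evid w (t \<^bold>+ s) A)"
| Bang: "adds L CS {Evid w t A} (Evid w (\<^bold>! t) (t \<^bold>: A))"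
| Mon: "adds L CS {Evid w t A, ERel w v} (Evid v t A)"
| AN: "JConst c \<^bold>: A \<in> CS \<Longrightarrow> adds L CS {} (Evid w (JConst c) A)"
| RE: "adds L CS {Rel w v} (ERel w v)"
| RefE: "adds L CS {} (ERel w w)"
| SymE: "L = S4LPN \<Longrightarrow> adds L CS {ERel w v} (ERel v w)"
| TransE: "adds L CS {ERel w v, ERel v u} (ERel w u)"

lemma member2_split:
  assumes "a \<in># \<Gamma>" "b \<in># \<Gamma>" "a \<noteq> b"
  obtains \<Gamma>' where "\<Gamma> = add_mset a (add_mset b \<Gamma>')"
  using assms by (metis insert_noteq_member mset_add)

text \<open>The side condition \<open>y \<notin># \<Gamma>\<close> disposes of the instances of \<open>Trans\<close> and \<open>TransE\<close> whose two
  principal atoms coincide, for which \<open>\<Gamma>\<close> need not contain two copies.\<close>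

lemma G3_adds:
  assumes "adds L CS P y" "P \<subseteq> set_mset \<Gamma>" "y \<notin># \<Gamma>" "G3 L CS (add_mset y \<Gamma>) \<Delta>"
  shows "G3 L CS \<Gamma> \<Delta>"
  using assms
proof (cases rule: adds.cases)
  case (Trans w v u)
  with assms(2,3) have "Rel w v \<in># \<Gamma>" "Rel v u \<in># \<Gamma>" "Rel w v \<noteq> Rel v u" by auto
  from member2_split[OF this] show ?thesis using assms(4) Trans G3.Trans by metis
next
  case (Box w A v)
  with assms(2) have "w \<^bold>\<tturnstile> \<^bold>\<box> A \<in># \<Gamma>" "Rel w v \<in># \<Gamma>" "w \<^bold>\<tturnstile> \<^bold>\<box> A \<noteq> Rel w v" by auto
  from member2_split[OF this] show ?thesis using assms(4) Box G3.LBox by metis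
next
  case (Just w t A v)
  with assms(2) have "w \<^bold>\<tturnstile> t \<^bold>: A \<in># \<Gamma>" "ERel w v \<in># \<Gamma>" "w \<^bold>\<tturnstile> t \<^bold>: A \<noteq> ERel w v" by auto
  from member2_split[OF this] show ?thesis using assms(4) Just G3.LJust by metis
next
  case (App w s A B t)
  \<comment> \<open>If s = t, the two evidence atoms could only coincide when the formulas do.
    Distinctness matters because the rule needs two separate occurrences in the multiset.\<close>
  have "A \<^bold>\<rightarrow> B \<noteq> A" by (induction A arbitrary: B) auto
  with App assms(2) have "Evid w s (A \<^bold>\<rightarrow> B) \<in># \<Gamma>" "Evid w t A \<in># \<Gamma>" "Evid w s (A \<^bold>\<rightarrow> B) \<noteq> Evid w t A"
    by auto
  from member2_split[OF this] show ?thesis using assms(4) App G3.EApp by metis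
next
  case (Mon w t A v)
  with assms(2) have "Evid w t A \<in># \<Gamma>" "ERel w v \<in># \<Gamma>" "Evid w t A \<noteq> ERel w v" by auto
  from member2_split[OF this] show ?thesis using assms(4) Mon G3.MonE by metis
next
  case (TransE w v u)
  with assms(2,3) have "ERel w v \<in># \<Gamma>" "ERel v u \<in># \<Gamma>" "ERel w v \<noteq> ERel v u" by auto
  from member2_split[OF this] show ?thesis using assms(4) TransE G3.TransE by metis
next
  case (E w t A)
  then show ?thesis using assms(2,4) by (auto dest!: multi_member_split intro: G3.E)
next
  case (SumL w t A s)
  then show ?thesis using assms(2,4) by (auto dest!: multi_member_split intro: G3.ElSum)
next
  case (SumR w t A s)
  then show ?thesis using assms(2,4) by (auto dest!: multi_member_split intro: G3.ErSum)
next
  case (Bang w t A)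
  then show ?thesis using assms(2,4) by (auto dest!: multi_member_split intro: G3.EBang)
next
  case (RE w v)
  then show ?thesis using assms(2,4) by (auto dest!: multi_member_split intro: G3.RE)
next
  case (SymE w v)
  then show ?thesis using assms(2,4) by (auto dest!: multi_member_split intro: G3.SymE)
qed (use assms(4) in \<open>auto intro: G3.Ref G3.AN G3.RefE\<close>)

text \<open>Records what the decomposition of an item leaves behind. The value is False for items
  that no left rule consumes (atoms, \<open>Box A\<close>, \<open>t : A\<close>), so an item of this
  kind that has ever occurred must still be in the current sequent.\<close>

fun left_done :: "item set \<Rightarrow> item set \<Rightarrow> item \<Rightarrow> bool" where
  "left_done G D (w \<^bold>\<tturnstile> \<^bold>\<not> A) \<longleftrightarrow> w \<^bold>\<tturnstile> A \<in> D"
| "left_done G D (w \<^bold>\<tturnstile> A \<^bold>\<and> B) \<longleftrightarrow> w \<^bold>\<tturnstile> A \<in> G \<and> w \<^bold>\<tturnstile> B \<in> G"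
| "left_done G D (w \<^bold>\<tturnstile> A \<^bold>\<or> B) \<longleftrightarrow> w \<^bold>\<tturnstile> A \<in> G \<or> w \<^bold>\<tturnstile> B \<in> G"
| "left_done G D (w \<^bold>\<tturnstile> A \<^bold>\<rightarrow> B) \<longleftrightarrow> w \<^bold>\<tturnstile> A \<in> D \<or> w \<^bold>\<tturnstile> B \<in> G"
| "left_done G D _ \<longleftrightarrow> False"

fun right_done :: "item set \<Rightarrow> item set \<Rightarrow> item \<Rightarrow> bool" where
  "right_done G D (w \<^bold>\<tturnstile> \<^bold>\<not> A) \<longleftrightarrow> w \<^bold>\<tturnstile> A \<in> G"
| "right_done G D (w \<^bold>\<tturnstile> A \<^bold>\<and> B) \<longleftrightarrow> w \<^bold>\<tturnstile> A \<in> D \<or> w \<^bold>\<tturnstile> B \<in> D"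
| "right_done G D (w \<^bold>\<tturnstile> A \<^bold>\<or> B) \<longleftrightarrow> w \<^bold>\<tturnstile> A \<in> D \<and> w \<^bold>\<tturnstile> B \<in> D"
| "right_done G D (w \<^bold>\<tturnstile> A \<^bold>\<rightarrow> B) \<longleftrightarrow> w \<^bold>\<tturnstile> A \<in> G \<and> w \<^bold>\<tturnstile> B \<in> D"
| "right_done G D (w \<^bold>\<tturnstile> \<^bold>\<box> A) \<longleftrightarrow> (\<exists>v. Rel w v \<in> G \<and> v \<^bold>\<tturnstile> A \<in> D)"
| "right_done G D (w \<^bold>\<tturnstile> t \<^bold>: A) \<longleftrightarrow> (\<exists>v. ERel w v \<in> G \<and> v \<^bold>\<tturnstile> A \<in> D)"
| "right_done G D _ \<longleftrightarrow> False"

fun left_reducible :: "item \<Rightarrow> bool" where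
  "left_reducible (w \<^bold>\<tturnstile> \<^bold>\<not> A) \<longleftrightarrow> True"
| "left_reducible (w \<^bold>\<tturnstile> A \<^bold>\<and> B) \<longleftrightarrow> True"
| "left_reducible (w \<^bold>\<tturnstile> A \<^bold>\<or> B) \<longleftrightarrow> True"
| "left_reducible (w \<^bold>\<tturnstile> A \<^bold>\<rightarrow> B) \<longleftrightarrow> True"
| "left_reducible _ \<longleftrightarrow> False"

text \<open>(R:) applies only when the matching evidence atom is on the left. If that atom never
  appears, \<open>t : A\<close> is false in the model for lack of evidence and needs no refuting
  successor.\<close>

fun right_reducible :: "item set \<Rightarrow> item \<Rightarrow> bool" where
  "right_reducible G (w \<^bold>\<tturnstile> \<^bold>\<not> A) \<longleftrightarrow> True"
| "right_reducible G (w \<^bold>\<tturnstile> A \<^bold>\<and> B) \<longleftrightarrow> True"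
| "right_reducible G (w \<^bold>\<tturnstile> A \<^bold>\<or> B) \<longleftrightarrow> True"
| "right_reducible G (w \<^bold>\<tturnstile> A \<^bold>\<rightarrow> B) \<longleftrightarrow> True"
| "right_reducible G (w \<^bold>\<tturnstile> \<^bold>\<box> A) \<longleftrightarrow> True"
| "right_reducible G (w \<^bold>\<tturnstile> t \<^bold>: A) \<longleftrightarrow> Evid w t A \<in> G"
| "right_reducible G _ \<longleftrightarrow> False"

lemma left_done_mono: "left_done G D x \<Longrightarrow> G \<subseteq> G' \<Longrightarrow> D \<subseteq> D' \<Longrightarrow> left_done G' D' x"
  by (induction G D x rule: left_done.induct) auto

lemma right_done_mono: "right_done G D x \<Longrightarrow> G \<subseteq> G' \<Longrightarrow> D \<subseteq> D' \<Longrightarrow> right_done G' D' x"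
  by (induction G D x rule: right_done.induct) auto

lemma right_reducible_mono: "right_reducible G x \<Longrightarrow> G \<subseteq> G' \<Longrightarrow> right_reducible G' x"
  by (induction G x rule: right_reducible.induct) auto

lemma adds_not_left_done: "adds L CS P y \<Longrightarrow> x \<in> P \<Longrightarrow> \<not> left_done G D x"
  by (induction rule: adds.induct) auto

lemma adds_finite: "adds L CS P y \<Longrightarrow> finite P"
  by (induction rule: adds.induct) auto

lemma left_done_D: "left_done G D x \<Longrightarrow> \<exists>w A. x = w \<^bold>\<tturnstile> A \<and> (\<forall>p. A \<noteq> PVar p)"
  by (cases "(G, D, x)" rule: left_done.cases) auto

lemma right_done_D: "right_done G D x \<Longrightarrow> \<exists>w A. x = w \<^bold>\<tturnstile> A \<and> (\<forall>p. A \<noteq> PVar p)"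
  by (cases "(G, D, x)" rule: right_done.cases) auto

text \<open>A compound formula may lie in both G and D, since initial sequents cover only
  propositional variables and atoms. No generalized initial sequents have to be derived: a clash
  within the code bound is excluded later by the truth lemma.\<close>

definition saturated :: "logic \<Rightarrow> fm set \<Rightarrow> item set \<Rightarrow> item set \<Rightarrow> bool" where
  "saturated L CS G D \<longleftrightarrow>
     (\<forall>P y. adds L CS P y \<longrightarrow> P \<subseteq> G \<longrightarrow> y \<in> G) \<and>
     (\<forall>x\<in>G. left_reducible x \<longrightarrow> left_done G D x) \<and>
     (\<forall>x\<in>D. right_reducible G x \<longrightarrow> right_done G D x) \<and>
     (\<forall>w. w \<^bold>\<tturnstile> \<^bold>\<bottom> \<notin> G) \<and>
     (\<forall>x\<in>G \<inter> D. \<exists>w A. x = w \<^bold>\<tturnstile> A \<and> (\<forall>p. A \<noteq> PVar p))"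

text \<open>A state of the root-first proof search: \<open>\<Gamma> \<Rightarrow> \<Delta>\<close> is the current sequent, \<open>G\<close> and \<open>D\<close>
  record the items that occurred so far; those no longer present have been decomposed.\<close>

type_synonym state = "item set \<times> item set \<times> item multiset \<times> item multiset"

fun search_state :: "logic \<Rightarrow> fm set \<Rightarrow> state \<Rightarrow> bool" where
  "search_state L CS (G, D, \<Gamma>, \<Delta>) \<longleftrightarrow> \<not> G3 L CS \<Gamma> \<Delta> \<and> set_mset \<Gamma> \<subseteq> G \<and> set_mset \<Delta> \<subseteq> D \<and>
     (\<forall>x\<in>G - set_mset \<Gamma>. left_done G D x) \<and> (\<forall>x\<in>D - set_mset \<Delta>. right_done G D x)"

fun extends :: "state \<Rightarrow> state \<Rightarrow> bool" where
  "extends (G, D, _) (G', D', _) \<longleftrightarrow> G \<subseteq> G' \<and> D \<subseteq> D'"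

lemma extends_refl: "extends S S"
  by (cases S) auto

lemma extends_trans: "extends S S' \<Longrightarrow> extends S' S'' \<Longrightarrow> extends S S''"
  by (cases S; cases S'; cases S'') auto

text \<open>One lemma for all left decompositions: \<open>\<Gamma>1\<close> and
  \<open>\<Delta>1\<close> are the items that the chosen premise puts in place of x. Earlier
  obligations survive because \<open>left_done\<close> and \<open>right_done\<close> are monotone in
  the records.\<close>

lemma search_state_left:
  assumes "search_state L CS (G, D, add_mset x \<Gamma>, \<Delta>)" "\<not> G3 L CS (\<Gamma>1 + \<Gamma>) (\<Delta>1 + \<Delta>)"
    "left_done (G \<union> set_mset \<Gamma>1) (D \<union> set_mset \<Delta>1) x"
  shows "search_state L CS (G \<union> set_mset \<Gamma>1, D \<union> set_mset \<Delta>1, \<Gamma>1 + \<Gamma>, \<Delta>1 + \<Delta>)"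
proof -
  have "left_done (G \<union> set_mset \<Gamma>1) (D \<union> set_mset \<Delta>1) y" if "y \<in> G" "y \<notin># \<Gamma>" for y
  proof (cases "y = x")
    case False
    then have "left_done G D y" using assms(1) that by auto
    then show ?thesis by (rule left_done_mono) auto
  qed (simp add: assms(3))
  moreover have "right_done (G \<union> set_mset \<Gamma>1) (D \<union> set_mset \<Delta>1) y" if "y \<in> D" "y \<notin># \<Delta>" for y
  proof -
    have "right_done G D y" using assms(1) that by auto
    then show ?thesis by (rule right_done_mono) auto
  qed
  ultimately show ?thesis using assms(1,2) by auto
qed

lemma search_state_right:
  assumes "search_state L CS (G, D, \<Gamma>, add_mset x \<Delta>)" "\<not> G3 L CS (\<Gamma>1 + \<Gamma>) (\<Delta>1 + \<Delta>)"
    "right_done (G \<union> set_mset \<Gamma>1) (D \<union> set_mset \<Delta>1) x"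
  shows "search_state L CS (G \<union> set_mset \<Gamma>1, D \<union> set_mset \<Delta>1, \<Gamma>1 + \<Gamma>, \<Delta>1 + \<Delta>)"
proof -
  have "right_done (G \<union> set_mset \<Gamma>1) (D \<union> set_mset \<Delta>1) y" if "y \<in> D" "y \<notin># \<Delta>" for y
  proof (cases "y = x")
    case False
    then have "right_done G D y" using assms(1) that by auto
    then show ?thesis by (rule right_done_mono) auto
  qed (simp add: assms(3))
  moreover have "left_done (G \<union> set_mset \<Gamma>1) (D \<union> set_mset \<Delta>1) y" if "y \<in> G" "y \<notin># \<Gamma>" for y
  proof -
    have "left_done G D y" using assms(1) that by auto
    then show ?thesis by (rule left_done_mono) auto
  qed
  ultimately show ?thesis using assms(1,2) by auto
qed

text \<open>The premises P are only known to lie in the record G, but by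
  \<open>adds_not_left_done\<close> such items are never decomposed, so they are still present in
  \<open>\<Gamma>\<close> and the rule is applicable.\<close>

lemma extend_adds:
  assumes "search_state L CS (G, D, \<Gamma>, \<Delta>)" "adds L CS P y" "P \<subseteq> G"
  shows "\<exists>S'. search_state L CS S' \<and> extends (G, D, \<Gamma>, \<Delta>) S' \<and> y \<in> fst S'"
proof (cases "y \<in> G")
  case True
  with assms(1) extends_refl show ?thesis by (intro exI[of _ "(G, D, \<Gamma>, \<Delta>)"]) auto
next
  case False
  have "\<forall>x\<in>P. \<not> left_done G D x" using adds_not_left_done[OF assms(2)] by blast
  then have "P \<subseteq> set_mset \<Gamma>" using assms(1,3) by auto
  then have "\<not> G3 L CS (add_mset y \<Gamma>) \<Delta>"
    using G3_adds[OF assms(2)] False assms(1) by auto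
  moreover have "\<forall>x\<in>insert y G - set_mset (add_mset y \<Gamma>). left_done (insert y G) D x"
    "\<forall>x\<in>D - set_mset \<Delta>. right_done (insert y G) D x"
    using assms(1) by (auto intro: left_done_mono[of G D] right_done_mono[of G D])
  ultimately show ?thesis
    using assms(1) by (intro exI[of _ "(insert y G, D, add_mset y \<Gamma>, \<Delta>)"]) auto
qed

lemma extend_left:
  assumes S: "search_state L CS (G, D, \<Gamma>, \<Delta>)" and x: "x \<in> G" "left_reducible x"
  shows "\<exists>S'. search_state L CS S' \<and> extends (G, D, \<Gamma>, \<Delta>) S' \<and> left_done (fst S') (fst (snd S')) x"
proof (cases "x \<in># \<Gamma>")
  case False
  then have "left_done G D x" using S x by auto
  with S extends_refl show ?thesis by (intro exI[of _ "(G, D, \<Gamma>, \<Delta>)"]) auto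
next
  case True
  then obtain \<Gamma>' where \<Gamma>: "\<Gamma> = add_mset x \<Gamma>'" by (metis multi_member_split)
  have nd: "\<not> G3 L CS (add_mset x \<Gamma>') \<Delta>" using S \<Gamma> by simp
  have *: ?thesis if "\<not> G3 L CS (\<Gamma>1 + \<Gamma>') (\<Delta>1 + \<Delta>)"
      "left_done (G \<union> set_mset \<Gamma>1) (D \<union> set_mset \<Delta>1) x" for \<Gamma>1 \<Delta>1
    using search_state_left[OF S[unfolded \<Gamma>] that] that(2)
    by (intro exI[of _ "(G \<union> set_mset \<Gamma>1, D \<union> set_mset \<Delta>1, \<Gamma>1 + \<Gamma>', \<Delta>1 + \<Delta>)"])
      (simp del: search_state.simps)
  from x(2) show ?thesis
  proof (cases x rule: left_reducible.cases)
    case (1 w A)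
    then show ?thesis using nd G3.LNeg by (intro *[of "{#}" "{#w \<^bold>\<tturnstile> A#}"]) auto
  next
    case (2 w A B)
    then show ?thesis using nd G3.LCon by (intro *[of "{#w \<^bold>\<tturnstile> A, w \<^bold>\<tturnstile> B#}" "{#}"]) auto
  next
    case (3 w A B)
    then have "\<not> G3 L CS (add_mset (w \<^bold>\<tturnstile> A) \<Gamma>') \<Delta> \<or> \<not> G3 L CS (add_mset (w \<^bold>\<tturnstile> B) \<Gamma>') \<Delta>"
      using nd G3.LDis by blast
    then show ?thesis
      using 3 *[of "{#w \<^bold>\<tturnstile> A#}" "{#}"] *[of "{#w \<^bold>\<tturnstile> B#}" "{#}"] by auto
  next
    case (4 w A B)
    then have "\<not> G3 L CS \<Gamma>' (add_mset (w \<^bold>\<tturnstile> A) \<Delta>) \<or> \<not> G3 L CS (add_mset (w \<^bold>\<tturnstile> B) \<Gamma>') \<Delta>"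
      using nd G3.LImp by blast
    then show ?thesis
      using 4 *[of "{#}" "{#w \<^bold>\<tturnstile> A#}"] *[of "{#w \<^bold>\<tturnstile> B#}" "{#}"] by auto
  qed auto
qed

lemma fresh_label: "\<exists>v. \<not> occurs v \<Gamma>"
proof -
  have "finite (labels x)" for x by (cases x) auto
  then have "finite (\<Union>x\<in>set_mset \<Gamma>. labels x)" by blast
  from ex_new_if_finite[OF infinite_UNIV_nat this] show ?thesis by (auto simp: occurs_def)
qed

lemma extend_right:
  assumes S: "search_state L CS (G, D, \<Gamma>, \<Delta>)" and x: "x \<in> D" "right_reducible G x"
  shows "\<exists>S'. search_state L CS S' \<and> extends (G, D, \<Gamma>, \<Delta>) S' \<and> right_done (fst S') (fst (snd S')) x"
proof (cases "x \<in># \<Delta>")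
  case False
  then have "right_done G D x" using S x by auto
  with S extends_refl show ?thesis by (intro exI[of _ "(G, D, \<Gamma>, \<Delta>)"]) auto
next
  case True
  then obtain \<Delta>' where \<Delta>: "\<Delta> = add_mset x \<Delta>'" by (metis multi_member_split)
  have nd: "\<not> G3 L CS \<Gamma> (add_mset x \<Delta>')" using S \<Delta> by simp
  have *: ?thesis if "\<not> G3 L CS (\<Gamma>1 + \<Gamma>) (\<Delta>1 + \<Delta>')"
      "right_done (G \<union> set_mset \<Gamma>1) (D \<union> set_mset \<Delta>1) x" for \<Gamma>1 \<Delta>1
    using search_state_right[OF S[unfolded \<Delta>] that] that(2)
    by (intro exI[of _ "(G \<union> set_mset \<Gamma>1, D \<union> set_mset \<Delta>1, \<Gamma>1 + \<Gamma>, \<Delta>1 + \<Delta>')"])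
      (simp del: search_state.simps)
  \<comment> \<open>Only the current finite sequent has to avoid v; saturation merely asks for the
    existence of a suitable label and imposes no freshness with respect to G and D.\<close>
  obtain v where "\<not> occurs v (\<Gamma> + add_mset x \<Delta>')" using fresh_label by blast
  then have v: "\<not> occurs v \<Gamma>" "\<not> occurs v (add_mset x \<Delta>')" by (auto simp: occurs_def)
  from x(2) show ?thesis
  proof (cases "(G, x)" rule: right_reducible.cases)
    case (1 G' w A)
    then show ?thesis using nd G3.RNeg by (intro *[of "{#w \<^bold>\<tturnstile> A#}" "{#}"]) auto
  next
    case (2 G' w A B)
    then have "\<not> G3 L CS \<Gamma> (add_mset (w \<^bold>\<tturnstile> A) \<Delta>') \<or> \<not> G3 L CS \<Gamma> (add_mset (w \<^bold>\<tturnstile> B) \<Delta>')"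
      using nd G3.RCon by blast
    then show ?thesis
      using 2 *[of "{#}" "{#w \<^bold>\<tturnstile> A#}"] *[of "{#}" "{#w \<^bold>\<tturnstile> B#}"] by auto
  next
    case (3 G' w A B)
    then show ?thesis using nd G3.RDis by (intro *[of "{#}" "{#w \<^bold>\<tturnstile> A, w \<^bold>\<tturnstile> B#}"]) auto
  next
    case (4 G' w A B)
    then show ?thesis using nd G3.RImp by (intro *[of "{#w \<^bold>\<tturnstile> A#}" "{#w \<^bold>\<tturnstile> B#}"]) auto
  next
    case (5 G' w A)
    then show ?thesis using nd G3.RBox[OF _ v(1)] v(2)
      by (intro *[of "{#Rel w v#}" "{#v \<^bold>\<tturnstile> A#}"]) auto
  next
    case (6 G' w t A)
    \<comment> \<open>The rule needs the evidence atom in the current sequent and not just in G. It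
      is still there because evidence atoms are never decomposed.\<close>
    have "\<not> left_done G D (Evid w t A)" by simp
    moreover have "Evid w t A \<in> G" using x(2) 6 by simp
    ultimately have "Evid w t A \<in># \<Gamma>" using S unfolding search_state.simps by blast
    then obtain \<Gamma>' where \<Gamma>: "\<Gamma> = add_mset (Evid w t A) \<Gamma>'" by (metis multi_member_split)
    then show ?thesis using 6 nd G3.RJust[OF _ v(1)[unfolded \<Gamma>]] v(2)
      by (intro *[of "{#ERel w v#}" "{#v \<^bold>\<tturnstile> A#}"]) (auto simp: add_mset_commute)
  qed auto
qed

text \<open>The search is scheduled by items and not by rule instances: all P that yield the same x
  make the same demand, namely that x enters G.\<close>

definition search_step :: "logic \<Rightarrow> fm set \<Rightarrow> item \<Rightarrow> state \<Rightarrow> state \<Rightarrow> bool" where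
  "search_step L CS x S S' \<longleftrightarrow> extends S S' \<and>
     (\<forall>P. adds L CS P x \<longrightarrow> P \<subseteq> fst S \<longrightarrow> x \<in> fst S') \<and>
     (x \<in> fst S \<longrightarrow> left_reducible x \<longrightarrow> left_done (fst S') (fst (snd S')) x) \<and>
     (x \<in> fst (snd S) \<longrightarrow> right_reducible (fst S) x \<longrightarrow> right_done (fst S') (fst (snd S')) x)"

lemma ex_search_step:
  assumes S: "search_state L CS S"
  shows "\<exists>S'. search_state L CS S' \<and> search_step L CS x S S'"
proof -
  obtain G D \<Gamma> \<Delta> where S_eq: "S = (G, D, \<Gamma>, \<Delta>)" by (cases S)
  obtain S1 where S1: "search_state L CS S1" "extends S S1"
      "\<forall>P. adds L CS P x \<longrightarrow> P \<subseteq> fst S \<longrightarrow> x \<in> fst S1"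
  proof (cases "\<exists>P. adds L CS P x \<and> P \<subseteq> fst S")
    case True
    then obtain P where "adds L CS P x" "P \<subseteq> G" by (auto simp: S_eq)
    from extend_adds[OF S[unfolded S_eq] this] show ?thesis using that unfolding S_eq by blast
  next
    case False
    then show ?thesis using that[OF S extends_refl] by blast
  qed
  obtain G1 D1 \<Gamma>1 \<Delta>1 where S1_eq: "S1 = (G1, D1, \<Gamma>1, \<Delta>1)" by (cases S1)
  obtain S2 where S2: "search_state L CS S2" "extends S1 S2"
      "x \<in> fst S1 \<longrightarrow> left_reducible x \<longrightarrow> left_done (fst S2) (fst (snd S2)) x"
  proof (cases "x \<in> fst S1 \<and> left_reducible x")
    case True
    then have "x \<in> G1" "left_reducible x" by (auto simp: S1_eq)
    from extend_left[OF S1(1)[unfolded S1_eq] this] show ?thesis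
      using that unfolding S1_eq by blast
  next
    case False
    then show ?thesis using that[OF S1(1) extends_refl] by blast
  qed
  obtain G2 D2 \<Gamma>2 \<Delta>2 where S2_eq: "S2 = (G2, D2, \<Gamma>2, \<Delta>2)" by (cases S2)
  obtain S3 where S3: "search_state L CS S3" "extends S2 S3"
      "x \<in> fst (snd S2) \<longrightarrow> right_reducible (fst S2) x \<longrightarrow> right_done (fst S3) (fst (snd S3)) x"
  proof (cases "x \<in> fst (snd S2) \<and> right_reducible (fst S2) x")
    case True
    then have "x \<in> D2" "right_reducible G2 x" by (auto simp: S2_eq)
    from extend_right[OF S2(1)[unfolded S2_eq] this] show ?thesis
      using that unfolding S2_eq by blast
  next
    case False
    then show ?thesis using that[OF S2(1) extends_refl] by blast
  qed
  obtain G3 D3 \<Gamma>3 \<Delta>3 where S3_eq: "S3 = (G3, D3, \<Gamma>3, \<Delta>3)" by (cases S3)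
  have sub: "G \<subseteq> G1" "D \<subseteq> D1" "G1 \<subseteq> G2" "D1 \<subseteq> D2" "G2 \<subseteq> G3" "D2 \<subseteq> D3"
    using S1(2) S2(2) S3(2) by (auto simp: S_eq S1_eq S2_eq S3_eq)
  have "search_step L CS x S S3"
    unfolding search_step_def
  proof (intro conjI allI impI)
    show "extends S S3" using S1(2) S2(2) S3(2) extends_trans by blast
  next
    fix P assume "adds L CS P x" "P \<subseteq> fst S"
    then show "x \<in> fst S3" using S1(3) sub by (auto simp: S1_eq S3_eq)
  next
    assume "x \<in> fst S" "left_reducible x"
    then have "left_done G2 D2 x" using S2(3) sub by (auto simp: S_eq S1_eq S2_eq)
    then show "left_done (fst S3) (fst (snd S3)) x"
      using sub by (auto simp: S3_eq intro: left_done_mono)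
  next
    assume "x \<in> fst (snd S)" "right_reducible (fst S) x"
    then show "right_done (fst S3) (fst (snd S3)) x"
      using S3(3) sub right_reducible_mono[of G x G2] by (auto simp: S_eq S2_eq)
  qed
  with S3(1) show ?thesis by blast
qed

theorem saturation:
  assumes "\<not> G3 L CS \<Gamma> \<Delta>"
  shows "\<exists>G D. saturated L CS G D \<and> set_mset \<Gamma> \<subseteq> G \<and> set_mset \<Delta> \<subseteq> D"
proof -
  \<comment> \<open>The second component of the pair is padding: it makes every item the target at
    arbitrarily late stages, which is the fairness of the search.\<close>
  define target where "target n = inv item_code (fst (prod_decode n))" for n
  have target: "\<exists>m\<ge>n. target m = x" for x n
  proof (intro exI conjI)
    show "n \<le> prod_encode (item_code x, n)" by (rule le_prod_encode_2)
    have "inj item_code" by (simp add: inj_def)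
    then show "target (prod_encode (item_code x, n)) = x" by (simp add: target_def)
  qed
  let ?S0 = "(set_mset \<Gamma>, set_mset \<Delta>, \<Gamma>, \<Delta>)"
  have "\<exists>f. \<forall>n. (search_state L CS (f n) \<and> (n = 0 \<longrightarrow> f n = ?S0)) \<and>
      search_step L CS (target n) (f n) (f (Suc n))"
  proof (rule dependent_nat_choice)
    show "\<exists>S. search_state L CS S \<and> ((0::nat) = 0 \<longrightarrow> S = ?S0)"
      using assms by (intro exI[of _ ?S0]) simp
  next
    fix S and n :: nat assume "search_state L CS S \<and> (n = 0 \<longrightarrow> S = ?S0)"
    then show "\<exists>S'. (search_state L CS S' \<and> (Suc n = 0 \<longrightarrow> S' = ?S0)) \<and>
        search_step L CS (target n) S S'"
      using ex_search_step by blast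
  qed
  then obtain f where f: "\<And>n. search_state L CS (f n)" "f 0 = ?S0"
      "\<And>n. search_step L CS (target n) (f n) (f (Suc n))" by metis
  define G where "G n = fst (f n)" for n
  define D where "D n = fst (snd (f n))" for n
  define \<Gamma>' where "\<Gamma>' n = fst (snd (snd (f n)))" for n
  define \<Delta>' where "\<Delta>' n = snd (snd (snd (f n)))" for n
  have f_eq: "f n = (G n, D n, \<Gamma>' n, \<Delta>' n)" for n
    by (simp add: G_def D_def \<Gamma>'_def \<Delta>'_def)
  have state: "search_state L CS (G n, D n, \<Gamma>' n, \<Delta>' n)" for n using f(1)[of n] f_eq by simp
  have step: "G n \<subseteq> G (Suc n)" "D n \<subseteq> D (Suc n)" for n
    using f(3)[of n] by (auto simp: search_step_def f_eq)
  have G_mono: "G m \<subseteq> G n" and D_mono: "D m \<subseteq> D n" if "m \<le> n" for m n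
    using that by (rule lift_Suc_mono_le[of G, OF step(1)] lift_Suc_mono_le[of D, OF step(2)])+
  let ?G = "\<Union>n. G n" and ?D = "\<Union>n. D n"
  have G_sub: "G n \<subseteq> ?G" and D_sub: "D n \<subseteq> ?D" for n by auto
  \<comment> \<open>Compactness along the chain: the finitely many premises of an added item are
    already all present at one stage.\<close>
  have fin: "\<exists>n. P \<subseteq> G n" if "finite P" "P \<subseteq> ?G" for P
    using that
  proof (induction P)
    case (insert x P)
    then obtain n m where "P \<subseteq> G n" "x \<in> G m" by auto
    then show ?case using G_mono[of n "max n m"] G_mono[of m "max n m"] by fastforce
  qed simp
  have "saturated L CS ?G ?D"
    unfolding saturated_def
  proof (intro conjI allI ballI impI)
    fix P y assume P: "adds L CS P y" "P \<subseteq> ?G"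
    obtain n where "P \<subseteq> G n" using fin[OF adds_finite[OF P(1)] P(2)] by blast
    moreover obtain m where m: "m \<ge> n" "target m = y" using target by blast
    ultimately have "P \<subseteq> G m" using G_mono by blast
    then have "y \<in> G (Suc m)" using f(3)[of m] P(1) m(2) by (auto simp: search_step_def f_eq)
    then show "y \<in> ?G" by blast
  next
    fix x assume x: "x \<in> ?G" "left_reducible x"
    then obtain n m where "x \<in> G n" "m \<ge> n" "target m = x" using target by blast
    then have "left_done (G (Suc m)) (D (Suc m)) x"
      using G_mono f(3)[of m] x(2) by (auto simp: search_step_def f_eq)
    then show "left_done ?G ?D x" using G_sub D_sub by (rule left_done_mono)
  next
    fix x assume x: "x \<in> ?D" "right_reducible ?G x"
    have "\<exists>k. right_reducible (G k) x"
      using x(2) by (cases "(?G, x)" rule: right_reducible.cases) auto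
    then obtain k where k: "right_reducible (G k) x" ..
    obtain n where n: "x \<in> D n" using x by blast
    obtain m where m: "m \<ge> max n k" "target m = x" using target by blast
    have "x \<in> D m" "right_reducible (G m) x"
      using m n D_mono[of n m] right_reducible_mono[OF k G_mono[of k m]] by auto
    then have "right_done (G (Suc m)) (D (Suc m)) x"
      using f(3)[of m] m(2) by (auto simp: search_step_def f_eq)
    then show "right_done ?G ?D x" using G_sub D_sub by (rule right_done_mono)
  next
    fix w show "w \<^bold>\<tturnstile> \<^bold>\<bottom> \<notin> ?G"
    proof
      assume "w \<^bold>\<tturnstile> \<^bold>\<bottom> \<in> ?G"
      then obtain n where "w \<^bold>\<tturnstile> \<^bold>\<bottom> \<in> G n" by blast
      moreover have "\<not> left_done (G n) (D n) (w \<^bold>\<tturnstile> \<^bold>\<bottom>)" by simp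
      ultimately have "w \<^bold>\<tturnstile> \<^bold>\<bottom> \<in># \<Gamma>' n"
        using state[of n] unfolding search_state.simps by blast
      then obtain M where "\<Gamma>' n = add_mset (w \<^bold>\<tturnstile> \<^bold>\<bottom>) M" by (metis multi_member_split)
      then show False using state[of n] G3.InitBot by auto
    qed
  next
    fix x assume "x \<in> ?G \<inter> ?D"
    then obtain n m where "x \<in> G n" "x \<in> D m" by blast
    then have x: "x \<in> G (max n m)" "x \<in> D (max n m)"
      using G_mono[of n "max n m"] D_mono[of m "max n m"] by auto
    show "\<exists>w A. x = w \<^bold>\<tturnstile> A \<and> (\<forall>p. A \<noteq> PVar p)"
    proof (rule ccontr)
      assume c: "\<not> ?thesis"
      \<comment> \<open>The assumption \<open>c\<close> leaves only propositional variables and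
        atoms, which are never decomposed. Such an x is still on both sides of the sequent at the
        common stage, which is therefore initial.\<close>
      then have "\<not> left_done G' D' x" "\<not> right_done G' D' x" for G' D'
        using left_done_D right_done_D by metis+
      then have "x \<in># \<Gamma>' (max n m)" "x \<in># \<Delta>' (max n m)"
        using state[of "max n m"] x unfolding search_state.simps by blast+
      then obtain M N where MN: "\<Gamma>' (max n m) = add_mset x M" "\<Delta>' (max n m) = add_mset x N"
        by (metis multi_member_split)
      have "G3 L CS (add_mset x M) (add_mset x N)"
        using c by (cases x) (auto intro: G3.intros)
      then show False using state[of "max n m"] MN by auto
    qed
  qed
  moreover have "set_mset \<Gamma> = G 0" "set_mset \<Delta> = D 0" using f(2) by (auto simp: G_def D_def)
  ultimately show ?thesis by blast
qed

subsection \<open>Countermodels coded by numbers\<close>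

text \<open>A world is coded by the finite set of its facts, tagged as follows: formulas that are (0) true
  and (1) false, (2) evidence, input labels from which the world is reachable along (3) \<open>R\<close> and
  (4) \<open>R\<^sup>e\<close>, and (5) input labels denoting it.  A model is coded by its set of worlds; the
  accessibility relations \<open>acc\<close> and \<open>acc_e\<close> are read off the facts.  The parameter \<open>x\<close>, later the
  input code, bounds all formulas, terms and labels that matter.\<close>

abbreviation "tr \<tau> a \<equiv> pr 0 a \<in> set_decode \<tau>"
abbreviation "fa \<tau> a \<equiv> pr 1 a \<in> set_decode \<tau>"
abbreviation "ev \<tau> t a \<equiv> pr 2 (pr t a) \<in> set_decode \<tau>"
abbreviation "seen \<tau> w \<equiv> pr 3 w \<in> set_decode \<tau>"
abbreviation "seen_e \<tau> w \<equiv> pr 4 w \<in> set_decode \<tau>"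
abbreviation "named \<tau> w \<equiv> pr 5 w \<in> set_decode \<tau>"

text \<open>This is a Lemmon-style filtration: it preserves \<open>t : A\<close> itself rather than
  A, and is a preorder for that reason. Preservation of evidence gives \<open>B_mono\<close>. The
  clause on \<open>seen_e\<close> keeps the relation small enough to refute evidence relational
  atoms on the right of the input.\<close>

definition le_e :: "nat \<Rightarrow> nat \<Rightarrow> nat \<Rightarrow> bool" where
  "le_e x \<tau> \<sigma> \<longleftrightarrow>
     (\<forall>t\<le>x. \<forall>a\<le>x. (tr \<tau> (pr 6 (pr t a)) \<longrightarrow> tr \<sigma> (pr 6 (pr t a))) \<and> (ev \<tau> t a \<longrightarrow> ev \<sigma> t a)) \<and>
     (\<forall>w\<le>x. seen_e \<tau> w \<longrightarrow> seen_e \<sigma> w)"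

definition acc_e :: "logic \<Rightarrow> nat \<Rightarrow> nat \<Rightarrow> nat \<Rightarrow> bool" where
  "acc_e L x \<tau> \<sigma> \<longleftrightarrow> le_e x \<tau> \<sigma> \<and> (L = S4LPN \<longrightarrow> le_e x \<sigma> \<tau>)"

definition acc :: "logic \<Rightarrow> nat \<Rightarrow> nat \<Rightarrow> nat \<Rightarrow> bool" where
  "acc L x \<tau> \<sigma> \<longleftrightarrow> acc_e L x \<tau> \<sigma> \<and> (\<forall>a\<le>x. tr \<tau> (pr 7 a) \<longrightarrow> tr \<sigma> (pr 7 a)) \<and>
     (\<forall>w\<le>x. seen \<tau> w \<longrightarrow> seen \<sigma> w)"

text \<open>Local Hintikka conditions; the inner tags 0 to 7 are those of \<open>fm_code\<close>.
  The clauses from \<open>Box a\<close> and from \<open>t : a\<close> to a complete the filtration: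
  the modal formula travels along the relation and is unpacked at the world reached.\<close>

definition truth_ok :: "nat \<Rightarrow> nat \<Rightarrow> bool" where
  "truth_ok x \<tau> \<longleftrightarrow>
     (\<forall>p\<le>x. \<not> (tr \<tau> (pr 0 p) \<and> fa \<tau> (pr 0 p))) \<and> \<not> tr \<tau> (pr 1 0) \<and>
     (\<forall>a\<le>x. (tr \<tau> (pr 2 a) \<longrightarrow> fa \<tau> a) \<and> (fa \<tau> (pr 2 a) \<longrightarrow> tr \<tau> a) \<and> (tr \<tau> (pr 7 a) \<longrightarrow> tr \<tau> a)) \<and>
     (\<forall>a\<le>x. \<forall>b\<le>x.
        (tr \<tau> (pr 3 (pr a b)) \<longrightarrow> tr \<tau> a \<and> tr \<tau> b) \<and> (fa \<tau> (pr 3 (pr a b)) \<longrightarrow> fa \<tau> a \<or> fa \<tau> b) \<and>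
        (tr \<tau> (pr 4 (pr a b)) \<longrightarrow> tr \<tau> a \<or> tr \<tau> b) \<and> (fa \<tau> (pr 4 (pr a b)) \<longrightarrow> fa \<tau> a \<and> fa \<tau> b) \<and>
        (tr \<tau> (pr 5 (pr a b)) \<longrightarrow> fa \<tau> a \<or> tr \<tau> b) \<and> (fa \<tau> (pr 5 (pr a b)) \<longrightarrow> tr \<tau> a \<and> fa \<tau> b)) \<and>
     (\<forall>t\<le>x. \<forall>a\<le>x. tr \<tau> (pr 6 (pr t a)) \<longrightarrow> tr \<tau> a \<and> ev \<tau> t a)"

definition term_code :: "nat \<Rightarrow> nat \<Rightarrow> bool" where
  "term_code x r \<longleftrightarrow> (\<forall>S<2 ^ Suc x.
     (\<forall>n\<le>x. (pr 0 n \<le> x \<longrightarrow> pr 0 n \<in> set_decode S) \<and> (pr 1 n \<le> x \<longrightarrow> pr 1 n \<in> set_decode S)) \<and>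
     (\<forall>s\<le>x. s \<in> set_decode S \<longrightarrow> (pr 4 s \<le> x \<longrightarrow> pr 4 s \<in> set_decode S) \<and>
        (\<forall>t\<le>x. t \<in> set_decode S \<longrightarrow>
           (pr 2 (pr s t) \<le> x \<longrightarrow> pr 2 (pr s t) \<in> set_decode S) \<and>
           (pr 3 (pr s t) \<le> x \<longrightarrow> pr 3 (pr s t) \<in> set_decode S))) \<longrightarrow>
     r \<in> set_decode S)"

text \<open>Closure under the evidence rules as far as the results stay within x. In the sum clauses
  s is not part of any given fact, hence the test \<open>term_code\<close>; without it, numbers that
  code no term would demand facts absent from the types of labels.\<close>

definition evidence_ok :: "nat \<Rightarrow> nat \<Rightarrow> bool" where
  "evidence_ok x \<tau> \<longleftrightarrow>
     (\<forall>s\<le>x. \<forall>t\<le>x. \<forall>a\<le>x.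
        (\<forall>b\<le>x. ev \<tau> s (pr 5 (pr a b)) \<and> ev \<tau> t a \<and> pr 2 (pr s t) \<le> x \<longrightarrow> ev \<tau> (pr 2 (pr s t)) b) \<and>
        (term_code x s \<and> ev \<tau> t a \<and> pr 3 (pr s t) \<le> x \<longrightarrow> ev \<tau> (pr 3 (pr s t)) a) \<and>
        (term_code x s \<and> ev \<tau> t a \<and> pr 3 (pr t s) \<le> x \<longrightarrow> ev \<tau> (pr 3 (pr t s)) a)) \<and>
     (\<forall>t\<le>x. \<forall>a\<le>x. ev \<tau> t a \<and> pr 4 t \<le> x \<and> pr 6 (pr t a) \<le> x \<longrightarrow> ev \<tau> (pr 4 t) (pr 6 (pr t a)))"

text \<open>The bound \<open>\<sigma> \<le> W\<close> loses nothing, as members of a decoded set are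
  smaller than its code; it only keeps the quantifier bounded. A false \<open>t : a\<close> needs a
  refuting successor just when evidence for it is present.\<close>

definition world_ok :: "logic \<Rightarrow> nat \<Rightarrow> nat \<Rightarrow> nat \<Rightarrow> nat \<Rightarrow> bool" where
  "world_ok L x cs W \<tau> \<longleftrightarrow> truth_ok x \<tau> \<and> evidence_ok x \<tau> \<and>
     (\<forall>c\<le>x. \<forall>a\<le>x. list_mem (pr 6 (pr (pr 1 c) a)) cs \<longrightarrow> ev \<tau> (pr 1 c) a) \<and>
     (\<forall>a\<le>x. fa \<tau> (pr 7 a) \<longrightarrow> (\<exists>\<sigma>\<le>W. \<sigma> \<in> set_decode W \<and> acc L x \<tau> \<sigma> \<and> fa \<sigma> a)) \<and>
     (\<forall>t\<le>x. \<forall>a\<le>x. fa \<tau> (pr 6 (pr t a)) \<and> ev \<tau> t a \<longrightarrow>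
        (\<exists>\<sigma>\<le>W. \<sigma> \<in> set_decode W \<and> acc_e L x \<tau> \<sigma> \<and> fa \<sigma> a))"

definition item_ok :: "nat \<Rightarrow> nat \<Rightarrow> nat \<Rightarrow> nat \<Rightarrow> nat \<Rightarrow> bool" where
  "item_ok x g d \<tau> w \<longleftrightarrow> (\<forall>a\<le>x.
     (list_mem (pr 0 (pr w a)) g \<longrightarrow> tr \<tau> a) \<and> (list_mem (pr 0 (pr w a)) d \<longrightarrow> fa \<tau> a) \<and>
     (\<forall>t\<le>x. (list_mem (pr 3 (pr w (pr t a))) g \<longrightarrow> ev \<tau> t a) \<and>
        (list_mem (pr 3 (pr w (pr t a))) d \<longrightarrow> \<not> ev \<tau> t a)))"

definition atom_ok :: "logic \<Rightarrow> nat \<Rightarrow> nat \<Rightarrow> nat \<Rightarrow> nat \<Rightarrow> nat \<Rightarrow> nat \<Rightarrow> nat \<Rightarrow> bool" where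
  "atom_ok L x g d \<tau> \<sigma> w v \<longleftrightarrow>
     (list_mem (pr 1 (pr w v)) g \<longrightarrow> acc L x \<tau> \<sigma>) \<and> (list_mem (pr 1 (pr w v)) d \<longrightarrow> \<not> acc L x \<tau> \<sigma>) \<and>
     (list_mem (pr 2 (pr w v)) g \<longrightarrow> acc_e L x \<tau> \<sigma>) \<and> (list_mem (pr 2 (pr w v)) d \<longrightarrow> \<not> acc_e L x \<tau> \<sigma>)"

text \<open>The conditions on input items range over all worlds named by a label, so any choice of a
  named world is a correct interpretation.\<close>

definition countermodel :: "logic \<Rightarrow> nat \<Rightarrow> nat \<Rightarrow> nat \<Rightarrow> nat \<Rightarrow> nat \<Rightarrow> bool" where
  "countermodel L x cs g d W \<longleftrightarrow>
     (\<forall>\<tau>\<le>W. \<tau> \<in> set_decode W \<longrightarrow> world_ok L x cs W \<tau>) \<and>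
     (\<forall>w\<le>x. \<exists>\<tau>\<le>W. \<tau> \<in> set_decode W \<and> named \<tau> w) \<and>
     (\<forall>\<tau>\<le>W. \<tau> \<in> set_decode W \<longrightarrow> (\<forall>w\<le>x. named \<tau> w \<longrightarrow> item_ok x g d \<tau> w \<and>
        (\<forall>\<sigma>\<le>W. \<sigma> \<in> set_decode W \<longrightarrow> (\<forall>v\<le>x. named \<sigma> v \<longrightarrow> atom_ok L x g d \<tau> \<sigma> w v))))"

text \<open>Origin of the bound: the tag of a fact is at most 5 and its content at most
  \<open>pr x x\<close>, so facts are at most \<open>pr 5 (pr x x)\<close>. Sets of facts then have
  codes below \<open>2 ^ Suc (pr 5 (pr x x))\<close>, and one more exponential bounds the sets of
  worlds.\<close>

definition refutable :: "logic \<Rightarrow> nat \<Rightarrow> bool" where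
  "refutable L x \<longleftrightarrow> (\<exists>cs\<le>x. \<exists>g\<le>x. \<exists>d\<le>x. x = pr cs (pr g d) \<and>
     (\<exists>W<2 ^ 2 ^ Suc (pr 5 (pr x x)). countermodel L x cs g d W))"

section \<open>Decidability of the coded conditions\<close>

lemma decidable_rel_le_e [computable_intros]:
  assumes "computable n f" "computable n g" "computable n h"
  shows "decidable_rel n (\<lambda>e. le_e (f e) (g e) (h e))"
  by (rule decidable_rel_lift3[where P = le_e, OF _ assms]) (unfold le_e_def, intro computable_intros)

lemma decidable_rel_acc_e [computable_intros]:
  assumes "computable n f" "computable n g" "computable n h"
  shows "decidable_rel n (\<lambda>e. acc_e L (f e) (g e) (h e))"
  unfolding acc_e_def by (intro computable_intros assms)

lemma decidable_rel_acc [computable_intros]: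
  assumes "computable n f" "computable n g" "computable n h"
  shows "decidable_rel n (\<lambda>e. acc L (f e) (g e) (h e))"
  by (rule decidable_rel_lift3[where P = "acc L", OF _ assms]) (unfold acc_def, intro computable_intros)

lemma decidable_rel_truth_ok [computable_intros]:
  assumes "computable n f" "computable n g"
  shows "decidable_rel n (\<lambda>e. truth_ok (f e) (g e))"
  by (rule decidable_rel_lift2[where P = truth_ok, OF _ assms])
    (unfold truth_ok_def, intro computable_intros)

lemma decidable_rel_term_code [computable_intros]:
  assumes "computable n f" "computable n g"
  shows "decidable_rel n (\<lambda>e. term_code (f e) (g e))"
  by (rule decidable_rel_lift2[where P = term_code, OF _ assms])
    (unfold term_code_def, intro computable_intros)

lemma decidable_rel_evidence_ok [computable_intros]:
  assumes "computable n f" "computable n g"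
  shows "decidable_rel n (\<lambda>e. evidence_ok (f e) (g e))"
  by (rule decidable_rel_lift2[where P = evidence_ok, OF _ assms])
    (unfold evidence_ok_def, intro computable_intros)

lemma decidable_rel_refutable: "decidable_rel (Suc 0) (\<lambda>e. refutable L (hd e))"
  unfolding refutable_def countermodel_def world_ok_def item_ok_def atom_ok_def
  by (intro computable_intros)

section \<open>Reading codes back as syntax\<close>

lemmas code_simps [simp] = tm_code.simps[folded pr_def] fm_code.simps[folded pr_def]
  item_code.simps[folded pr_def]

declare tm_code.simps [simp del] fm_code.simps [simp del] item_code.simps [simp del]

lemma fm_code_eq_pr:
  "fm_code A = pr 0 p \<longleftrightarrow> A = PVar p"
  "fm_code A = pr (Suc 0) 0 \<longleftrightarrow> A = \<^bold>\<bottom>"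
  "fm_code A = pr 2 b \<longleftrightarrow> (\<exists>B. A = \<^bold>\<not> B \<and> b = fm_code B)"
  "fm_code A = pr 3 (pr b c) \<longleftrightarrow> (\<exists>B C. A = B \<^bold>\<and> C \<and> b = fm_code B \<and> c = fm_code C)"
  "fm_code A = pr 4 (pr b c) \<longleftrightarrow> (\<exists>B C. A = B \<^bold>\<or> C \<and> b = fm_code B \<and> c = fm_code C)"
  "fm_code A = pr 5 (pr b c) \<longleftrightarrow> (\<exists>B C. A = B \<^bold>\<rightarrow> C \<and> b = fm_code B \<and> c = fm_code C)"
  "fm_code A = pr 6 (pr t' b) \<longleftrightarrow> (\<exists>t B. A = t \<^bold>: B \<and> t' = tm_code t \<and> b = fm_code B)"
  "fm_code A = pr 7 b \<longleftrightarrow> (\<exists>B. A = \<^bold>\<box> B \<and> b = fm_code B)"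
  by (cases A; auto)+

lemmas pr_eq_fm_code = fm_code_eq_pr[THEN trans[OF eq_commute]]

lemma set_decode_less: "a \<in> set_decode s \<Longrightarrow> a < s"
proof -
  assume "a \<in> set_decode s"
  then have "s div 2 ^ a \<noteq> 0" by (auto simp: set_decode_def elim: oddE)
  then have "2 ^ a \<le> s" by (metis div_less not_le_imp_less)
  then show "a < s" using less_exp[of a] by linarith
qed

text \<open>The term codes up to x form the least set with the closure properties of
  \<open>term_code\<close>: it serves as S in one direction, and structural induction puts it inside
  every admissible S in the other. The bound on r is needed because an admissible S is controlled
  only up to x.\<close>

lemma term_code_iff:
  assumes "r \<le> x"
  shows "term_code x r \<longleftrightarrow> (\<exists>t. r = tm_code t)"
proof
  let ?S = "{c. c \<le> x \<and> c \<in> range tm_code}"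
  assume r: "term_code x r"
  have sub: "?S \<subseteq> {..<Suc x}" by auto
  then have dec: "set_decode (set_encode ?S) = ?S"
    by (intro set_encode_inverse finite_subset[OF sub]) simp
  have "pr 0 n \<in> range tm_code" "pr 1 n \<in> range tm_code" for n
    using rangeI[of tm_code "JVar n"] rangeI[of tm_code "JConst n"] by simp_all
  moreover have "pr 4 a \<in> range tm_code \<and> pr 2 (pr a b) \<in> range tm_code \<and> pr 3 (pr a b) \<in> range tm_code"
    if ab: "a \<in> range tm_code" "b \<in> range tm_code" for a b
  proof -
    obtain s t where "a = tm_code s" "b = tm_code t" using ab by blast
    then show ?thesis
      using rangeI[of tm_code "\<^bold>! s"] rangeI[of tm_code "s \<^bold>\<cdot> t"] rangeI[of tm_code "s \<^bold>+ t"] by simp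
  qed
  ultimately have "r \<in> ?S"
    using r[unfolded term_code_def, rule_format, OF set_encode_less[OF sub]] unfolding dec by simp
  then show "\<exists>t. r = tm_code t" by blast
next
  assume "\<exists>t. r = tm_code t"
  then obtain t where t: "r = tm_code t" ..
  show "term_code x r"
    unfolding term_code_def
  proof (intro allI impI, elim conjE)
    fix S
    assume base: "\<forall>n\<le>x. (pr 0 n \<le> x \<longrightarrow> pr 0 n \<in> set_decode S) \<and>
        (pr 1 n \<le> x \<longrightarrow> pr 1 n \<in> set_decode S)"
      and step: "\<forall>s\<le>x. s \<in> set_decode S \<longrightarrow> (pr 4 s \<le> x \<longrightarrow> pr 4 s \<in> set_decode S) \<and>
        (\<forall>t\<le>x. t \<in> set_decode S \<longrightarrow>
           (pr 2 (pr s t) \<le> x \<longrightarrow> pr 2 (pr s t) \<in> set_decode S) \<and>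
           (pr 3 (pr s t) \<le> x \<longrightarrow> pr 3 (pr s t) \<in> set_decode S))"
    have "tm_code t \<le> x \<longrightarrow> tm_code t \<in> set_decode S" for t
    proof (induction t)
      case (App s t)
      have "tm_code s \<le> x" "tm_code t \<le> x" if "tm_code (s \<^bold>\<cdot> t) \<le> x"
        using that by (auto dest!: pr_le_D)
      with App step show ?case by auto
    next
      case (Sum s t)
      have "tm_code s \<le> x" "tm_code t \<le> x" if "tm_code (s \<^bold>+ t) \<le> x"
        using that by (auto dest!: pr_le_D)
      with Sum step show ?case by auto
    qed (use base step in \<open>auto dest: pr_le_D\<close>)
    then show "r \<in> set_decode S" using t assms by blast
  qed
qed

lemma list_mem_map_code:
  "list_mem (fm_code A) (list_encode (map fm_code cs)) \<longleftrightarrow> A \<in> set cs"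
  "list_mem (item_code y) (list_encode (map item_code ys)) \<longleftrightarrow> y \<in> set ys"
  by (auto simp: list_mem_list_encode image_iff)

subsection \<open>From coded countermodels to models\<close>

text \<open>The evidence facts of a world are closed only within the codes up to \<open>x\<close>.  Generating all
  evidence from them adds no fact below \<open>x\<close>, since \<open>A\<close> is a subformula of the implication eliminated
  in an application, and that implication never comes from \<open>\<^bold>!\<close>.\<close>

lemma evidence_restrict:
  assumes "evidence_ok x \<tau>"
    and "evidence (\<lambda>t A. tm_code t \<le> x \<and> fm_code A \<le> x \<and> ev \<tau> (tm_code t) (fm_code A)) t A"
  shows "(fm_code A \<le> x \<or> (\<exists>s C. A = s \<^bold>: C)) \<and>
    (tm_code t \<le> x \<longrightarrow> fm_code A \<le> x \<longrightarrow> ev \<tau> (tm_code t) (fm_code A))"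
  using assms(2)
proof (induction rule: evidence.induct)
  case (base t A)
  then show ?case by auto
next
  case (app s A C t)
  then have "fm_code (A \<^bold>\<rightarrow> C) \<le> x" by auto
  then have le: "fm_code A \<le> x" "fm_code C \<le> x" by (auto dest!: pr_le_D)
  have "ev \<tau> (tm_code (s \<^bold>\<cdot> t)) (fm_code C)" if st: "tm_code (s \<^bold>\<cdot> t) \<le> x"
  proof -
    have "tm_code s \<le> x" "tm_code t \<le> x"
      using st by (auto dest!: pr_le_D)
    then show ?thesis
      using app le \<open>fm_code (A \<^bold>\<rightarrow> C) \<le> x\<close> st assms(1)[unfolded evidence_ok_def]
      by auto
  qed
  with le show ?case by blast
next
  case (suml t A s)
  have "ev \<tau> (tm_code (s \<^bold>+ t)) (fm_code A)" if st: "tm_code (s \<^bold>+ t) \<le> x" "fm_code A \<le> x"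
  proof -
    have "tm_code s \<le> x" "tm_code t \<le> x"
      using st by (auto dest!: pr_le_D)
    then show ?thesis
      using suml st assms(1)[unfolded evidence_ok_def] by (auto simp: term_code_iff)
  qed
  with suml show ?case by blast
next
  case (sumr t A s)
  have "ev \<tau> (tm_code (t \<^bold>+ s)) (fm_code A)" if st: "tm_code (t \<^bold>+ s) \<le> x" "fm_code A \<le> x"
  proof -
    have "tm_code s \<le> x" "tm_code t \<le> x"
      using st by (auto dest!: pr_le_D)
    then show ?thesis
      using sumr st assms(1)[unfolded evidence_ok_def] by (auto simp: term_code_iff)
  qed
  with sumr show ?case by blast
next
  case (bang t A)
  have "ev \<tau> (tm_code (\<^bold>! t)) (fm_code (t \<^bold>: A))" if st: "tm_code (\<^bold>! t) \<le> x" "fm_code (t \<^bold>: A) \<le> x"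
  proof -
    have "tm_code t \<le> x" "fm_code A \<le> x"
      using st by (auto dest!: pr_le_D)
    then show ?thesis
      using bang st assms(1)[unfolded evidence_ok_def]
      by auto
  qed
  then show ?case by blast
qed

lemma truth_ok_binary:
  assumes "truth_ok x \<tau>" "a \<le> x" "b \<le> x"
  shows "tr \<tau> (pr 3 (pr a b)) \<Longrightarrow> tr \<tau> a \<and> tr \<tau> b" "fa \<tau> (pr 3 (pr a b)) \<Longrightarrow> fa \<tau> a \<or> fa \<tau> b"
    "tr \<tau> (pr 4 (pr a b)) \<Longrightarrow> tr \<tau> a \<or> tr \<tau> b" "fa \<tau> (pr 4 (pr a b)) \<Longrightarrow> fa \<tau> a \<and> fa \<tau> b"
    "tr \<tau> (pr 5 (pr a b)) \<Longrightarrow> fa \<tau> a \<or> tr \<tau> b" "fa \<tau> (pr 5 (pr a b)) \<Longrightarrow> tr \<tau> a \<and> fa \<tau> b"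
  using assms by (simp_all add: truth_ok_def)

lemma le_e_refl: "le_e x \<tau> \<tau>"
  by (simp add: le_e_def)

lemma le_e_trans: "le_e x \<tau> \<sigma> \<Longrightarrow> le_e x \<sigma> \<upsilon> \<Longrightarrow> le_e x \<tau> \<upsilon>"
  by (auto simp: le_e_def)

lemma countermodel_sound:
  assumes cm: "countermodel L x (list_encode (map fm_code cs))
      (list_encode (map item_code \<Gamma>)) (list_encode (map item_code \<Delta>)) W"
    and cs: "\<And>A. A \<in> set cs \<Longrightarrow> fm_code A \<le> x"
    and items: "\<And>y. y \<in> set \<Gamma> \<union> set \<Delta> \<Longrightarrow> item_code y \<le> x"
  shows "\<not> G3 L (set cs) (mset \<Gamma>) (mset \<Delta>)"
proof -
  let ?W = "set_decode W"
  let ?B = "\<lambda>\<tau> t A. tm_code t \<le> x \<and> fm_code A \<le> x \<and> ev \<tau> (tm_code t) (fm_code A)"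
  have le_W: "\<tau> \<le> W" if "\<tau> \<in> ?W" for \<tau> using that set_decode_less less_imp_le by blast
  have world: "world_ok L x (list_encode (map fm_code cs)) W \<tau>" if "\<tau> \<in> ?W" for \<tau>
    using cm le_W[OF that] that by (simp add: countermodel_def)
  have ok: "truth_ok x \<tau>" "evidence_ok x \<tau>" if "\<tau> \<in> ?W" for \<tau>
    using world[OF that] by (simp_all add: world_ok_def)
  have ok_CS: "ev \<tau> (pr 1 c) a" if "\<tau> \<in> ?W" "c \<le> x" "a \<le> x"
      "list_mem (pr 6 (pr (pr 1 c) a)) (list_encode (map fm_code cs))" for \<tau> c a
    using world[OF that(1)] that(2-) by (simp add: world_ok_def)
  have ok_Box: "\<exists>\<sigma>\<in>?W. acc L x \<tau> \<sigma> \<and> fa \<sigma> a" if "\<tau> \<in> ?W" "a \<le> x" "fa \<tau> (pr 7 a)" for \<tau> a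
    using world[OF that(1)] that(2-) unfolding world_ok_def by meson
  have ok_Just: "\<exists>\<sigma>\<in>?W. acc_e L x \<tau> \<sigma> \<and> fa \<sigma> a"
    if "\<tau> \<in> ?W" "t \<le> x" "a \<le> x" "fa \<tau> (pr 6 (pr t a))" "ev \<tau> t a" for \<tau> t a
    using world[OF that(1)] that(2-) unfolding world_ok_def by meson
  have "fitting_model L (set cs) ?W (acc L x) (acc_e L x) ?B"
  proof
    fix \<tau> c A assume \<tau>: "\<tau> \<in> ?W" and A: "JConst c \<^bold>: A \<in> set cs"
    have "pr 6 (pr (pr 1 c) (fm_code A)) \<le> x" using cs[OF A] by simp
    then have le: "c \<le> x" "pr 1 c \<le> x" "fm_code A \<le> x" by (auto dest!: pr_le_D)
    have "list_mem (fm_code (JConst c \<^bold>: A)) (list_encode (map fm_code cs))"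
      using A by (simp only: list_mem_map_code)
    then have "ev \<tau> (pr 1 c) (fm_code A)" using ok_CS[OF \<tau> le(1,3)] by simp
    then show "?B \<tau> (JConst c) A" using le by simp
  next
    fix \<tau> \<sigma> t A assume "acc_e L x \<tau> \<sigma>" "?B \<tau> t A"
    then show "?B \<sigma> t A" by (auto simp: acc_e_def le_e_def)
  qed (auto simp: acc_def acc_e_def le_e_refl intro: le_e_trans)
  then interpret fitting_model L "set cs" ?W "acc L x" "acc_e L x" ?B "\<lambda>\<tau> p. tr \<tau> (pr 0 p)" .
  have evidence_iff: "evidence (?B \<tau>) t A \<longleftrightarrow> ev \<tau> (tm_code t) (fm_code A)"
    if "\<tau> \<in> ?W" "tm_code t \<le> x" "fm_code A \<le> x" for \<tau> t A
    using evidence_restrict[OF ok(2)[OF that(1)]] that by (auto intro: evidence.base)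
  \<comment> \<open>Two one-way implications, since a world may decide neither A nor its negation.
    Their conjunction also shows that no world lists a formula within the bound as both true and
    false.\<close>
  have truth: "(tr \<tau> (fm_code A) \<longrightarrow> holds \<tau> A) \<and> (fa \<tau> (fm_code A) \<longrightarrow> \<not> holds \<tau> A)"
    if "\<tau> \<in> ?W" "fm_code A \<le> x" for \<tau> A
    using that
  proof (induction A arbitrary: \<tau>)
    case (PVar p)
    then have "p \<le> x" by (auto dest!: pr_le_D)
    then show ?case using ok(1)[OF PVar(1), unfolded truth_ok_def]
      by auto
  next
    case Falsum
    then show ?case using ok(1)[OF Falsum(1), unfolded truth_ok_def]
      by auto
  next
    case (Neg A)
    then have "fm_code A \<le> x" by (auto dest!: pr_le_D)
    then show ?case using ok(1)[OF Neg(2), unfolded truth_ok_def] Neg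
      by auto
  next
    case (Con A C)
    then have le: "fm_code A \<le> x" "fm_code C \<le> x"
      by (auto dest!: pr_le_D)
    show ?case
      using truth_ok_binary(1,2)[OF ok(1)[OF Con.prems(1)] le] Con.IH[OF Con.prems(1)] le
      by auto
  next
    case (Dis A C)
    then have le: "fm_code A \<le> x" "fm_code C \<le> x"
      by (auto dest!: pr_le_D)
    show ?case
      using truth_ok_binary(3,4)[OF ok(1)[OF Dis.prems(1)] le] Dis.IH[OF Dis.prems(1)] le
      by auto
  next
    case (Imp A C)
    then have le: "fm_code A \<le> x" "fm_code C \<le> x"
      by (auto dest!: pr_le_D)
    show ?case
      using truth_ok_binary(5,6)[OF ok(1)[OF Imp.prems(1)] le] Imp.IH[OF Imp.prems(1)] le
      by auto
  next
    case (Just t A)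
    then have le: "tm_code t \<le> x" "fm_code A \<le> x"
      by (auto dest!: pr_le_D)
    have code: "fm_code (t \<^bold>: A) = pr 6 (pr (tm_code t) (fm_code A))"
      by simp
    show ?case
    proof (intro conjI impI)
      assume tr: "tr \<tau> (fm_code (t \<^bold>: A))"
      have "holds \<sigma> A" if \<sigma>: "\<sigma> \<in> ?W" "acc_e L x \<tau> \<sigma>" for \<sigma>
      proof -
        have "tr \<sigma> (fm_code (t \<^bold>: A))" using tr \<sigma>(2) le by (simp add: code acc_e_def le_e_def)
        then have "tr \<sigma> (fm_code A)" using ok(1)[OF \<sigma>(1), unfolded truth_ok_def] le code by auto
        then show ?thesis using Just.IH[OF \<sigma>(1)] le by blast
      qed
      moreover have "ev \<tau> (tm_code t) (fm_code A)"
        using ok(1)[OF Just.prems(1), unfolded truth_ok_def] tr le code by auto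
      ultimately show "holds \<tau> (t \<^bold>: A)" using evidence_iff[OF Just.prems(1) le] by simp
    next
      assume fa: "fa \<tau> (fm_code (t \<^bold>: A))"
      show "\<not> holds \<tau> (t \<^bold>: A)"
      proof
        assume h: "holds \<tau> (t \<^bold>: A)"
        then have "ev \<tau> (tm_code t) (fm_code A)" using evidence_iff[OF Just.prems(1) le] by simp
        then obtain \<sigma> where \<sigma>: "\<sigma> \<in> ?W" "acc_e L x \<tau> \<sigma>" "fa \<sigma> (fm_code A)"
          using ok_Just[OF Just.prems(1) le] fa code by auto
        then show False using h Just.IH[OF \<sigma>(1) le(2)] by auto
      qed
    qed
  next
    case (Box A)
    then have le: "fm_code A \<le> x"
      by (auto dest!: pr_le_D)
    have code: "fm_code (\<^bold>\<box> A) = pr 7 (fm_code A)"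
      by simp
    show ?case
    proof (intro conjI impI)
      assume tr: "tr \<tau> (fm_code (\<^bold>\<box> A))"
      have "holds \<sigma> A" if \<sigma>: "\<sigma> \<in> ?W" "acc L x \<tau> \<sigma>" for \<sigma>
      proof -
        have "tr \<sigma> (fm_code (\<^bold>\<box> A))" using tr \<sigma>(2) le by (simp add: code acc_def)
        then have "tr \<sigma> (fm_code A)" using ok(1)[OF \<sigma>(1), unfolded truth_ok_def] le code by auto
        then show ?thesis using Box.IH[OF \<sigma>(1)] le by blast
      qed
      then show "holds \<tau> (\<^bold>\<box> A)" by simp
    next
      assume fa: "fa \<tau> (fm_code (\<^bold>\<box> A))"
      obtain \<sigma> where \<sigma>: "\<sigma> \<in> ?W" "acc L x \<tau> \<sigma>" "fa \<sigma> (fm_code A)"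
        using ok_Box[OF Box.prems(1) le] fa code by auto
      then show "\<not> holds \<tau> (\<^bold>\<box> A)" using Box.IH[OF \<sigma>(1) le] by auto
    qed
  qed
  \<comment> \<open>Labels above x occur in no input item and may be sent anywhere; label 0 always
    satisfies the bound and so supplies a world for them.\<close>
  have "\<exists>\<tau>\<in>?W. w \<le> x \<longrightarrow> named \<tau> w" for w
    using cm[unfolded countermodel_def] by (metis le0)
  then obtain \<rho> where \<rho>: "\<And>w. \<rho> w \<in> ?W" "\<And>w. w \<le> x \<Longrightarrow> named (\<rho> w) w" by metis
  let ?g = "list_encode (map item_code \<Gamma>)" and ?d = "list_encode (map item_code \<Delta>)"
  have item: "item_ok x ?g ?d (\<rho> w) w" if "w \<le> x" for w
    using cm le_W[OF \<rho>(1)] \<rho>(1) \<rho>(2)[OF that] that by (simp add: countermodel_def)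
  have atom: "atom_ok L x ?g ?d (\<rho> w) (\<rho> v) w v" if "w \<le> x" "v \<le> x" for w v
    using cm le_W[OF \<rho>(1)] \<rho>(1) \<rho>(2)[OF that(1)] \<rho>(2)[OF that(2)] that
    by (simp add: countermodel_def)
  have mem: "y \<in> set \<Gamma> \<longleftrightarrow> list_mem (item_code y) ?g" "y \<in> set \<Delta> \<longleftrightarrow> list_mem (item_code y) ?d" for y
    by (simp_all only: list_mem_map_code)
  have sat: "(y \<in> set \<Gamma> \<longrightarrow> sat \<rho> y) \<and> (y \<in> set \<Delta> \<longrightarrow> \<not> sat \<rho> y)" if "item_code y \<le> x" for y
  proof (cases y)
    case (Forces w A)
    then have le: "w \<le> x" "fm_code A \<le> x" using that by (auto dest!: pr_le_D)
    show ?thesis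
      using truth[OF \<rho>(1)[of w] le(2)] item[OF le(1)] le(2) unfolding Forces mem item_ok_def by simp
  next
    case (Rel w v)
    then have le: "w \<le> x" "v \<le> x" using that by (auto dest!: pr_le_D)
    show ?thesis using atom[OF le] unfolding Rel mem atom_ok_def by simp
  next
    case (ERel w v)
    then have le: "w \<le> x" "v \<le> x" using that by (auto dest!: pr_le_D)
    show ?thesis using atom[OF le] unfolding ERel mem atom_ok_def by simp
  next
    case (Evid w t A)
    then have le: "w \<le> x" "tm_code t \<le> x" "fm_code A \<le> x" using that by (auto dest!: pr_le_D)
    show ?thesis
      using evidence_iff[OF \<rho>(1)[of w] le(2,3)] item[OF le(1)] le(2,3)
      unfolding Evid mem item_ok_def by simp
  qed
  show ?thesis
  proof
    assume "G3 L (set cs) (mset \<Gamma>) (mset \<Delta>)"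
    from soundness[OF this, of \<rho>] show False using \<rho>(1) sat items by auto
  qed
qed

subsection \<open>From saturated pairs to coded countermodels\<close>

lemma pr_eq_item_code:
  "pr 0 (pr w a) = item_code y \<longleftrightarrow> (\<exists>A. y = w \<^bold>\<tturnstile> A \<and> a = fm_code A)"
  "pr 3 (pr w (pr t' a)) = item_code y \<longleftrightarrow>
     (\<exists>t A. y = Evid w t A \<and> t' = tm_code t \<and> a = fm_code A)"
  by (cases y; auto)+

text \<open>The calculus propagates \<open>A\<close>, but not \<open>\<^bold>\<box> A\<close> or \<open>t \<^bold>: A\<close> themselves, along relational atoms;
  adding the inherited ones makes \<open>acc\<close> and \<open>acc_e\<close> hold between the types of related labels.\<close>

definition inherited :: "item set \<Rightarrow> label \<Rightarrow> fm \<Rightarrow> bool" where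
  "inherited G u A \<longleftrightarrow> u \<^bold>\<tturnstile> A \<in> G \<or>
     (\<exists>v B. A = \<^bold>\<box> B \<and> Rel v u \<in> G \<and> v \<^bold>\<tturnstile> A \<in> G) \<or>
     (\<exists>v t B. A = t \<^bold>: B \<and> ERel v u \<in> G \<and> v \<^bold>\<tturnstile> A \<in> G)"

text \<open>Every component is cut off at x, so the set is finite although G and D may be infinite.
  The last component keeps each label u up to x apart from all others, so that exactly one type is
  named u; it is empty for larger labels.\<close>

definition label_type :: "nat \<Rightarrow> item set \<Rightarrow> item set \<Rightarrow> label \<Rightarrow> nat" where
  "label_type x G D u = set_encode (
     {pr 0 (fm_code A) |A. fm_code A \<le> x \<and> inherited G u A} \<union>
     {pr 1 (fm_code A) |A. fm_code A \<le> x \<and> u \<^bold>\<tturnstile> A \<in> D} \<union>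
     {pr 2 (pr (tm_code t) (fm_code A)) |t A. tm_code t \<le> x \<and> fm_code A \<le> x \<and> Evid u t A \<in> G} \<union>
     {pr 3 w |w. w \<le> x \<and> Rel w u \<in> G} \<union>
     {pr 4 w |w. w \<le> x \<and> ERel w u \<in> G} \<union>
     {pr 5 w |w. w \<le> x \<and> w = u})"

lemma label_type_bound:
  shows label_type_less: "label_type x G D u < 2 ^ Suc (pr 5 (pr x x))"
    and set_decode_label_type: "set_decode (label_type x G D u) =
     {pr 0 (fm_code A) |A. fm_code A \<le> x \<and> inherited G u A} \<union>
     {pr 1 (fm_code A) |A. fm_code A \<le> x \<and> u \<^bold>\<tturnstile> A \<in> D} \<union>
     {pr 2 (pr (tm_code t) (fm_code A)) |t A. tm_code t \<le> x \<and> fm_code A \<le> x \<and> Evid u t A \<in> G} \<union>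
     {pr 3 w |w. w \<le> x \<and> Rel w u \<in> G} \<union>
     {pr 4 w |w. w \<le> x \<and> ERel w u \<in> G} \<union>
     {pr 5 w |w. w \<le> x \<and> w = u}" (is "_ = ?S")
proof -
  have "c \<le> pr x x" if "c \<le> x" for c using that le_pr order_trans by blast
  then have sub: "?S \<subseteq> {..<Suc (pr 5 (pr x x))}"
    by (auto simp: less_Suc_eq_le intro!: pr_mono)
  show "label_type x G D u < 2 ^ Suc (pr 5 (pr x x))"
    unfolding label_type_def by (rule set_encode_less[OF sub])
  show "set_decode (label_type x G D u) = ?S"
    unfolding label_type_def by (rule set_encode_inverse[OF finite_subset[OF sub]]) simp
qed

lemma label_type_facts:
  "tr (label_type x G D u) a \<longleftrightarrow> (\<exists>A. a = fm_code A \<and> fm_code A \<le> x \<and> inherited G u A)"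
  "fa (label_type x G D u) a \<longleftrightarrow> (\<exists>A. a = fm_code A \<and> fm_code A \<le> x \<and> u \<^bold>\<tturnstile> A \<in> D)"
  "ev (label_type x G D u) t' a \<longleftrightarrow>
     (\<exists>t A. t' = tm_code t \<and> a = fm_code A \<and> tm_code t \<le> x \<and> fm_code A \<le> x \<and> Evid u t A \<in> G)"
  "seen (label_type x G D u) w \<longleftrightarrow> w \<le> x \<and> Rel w u \<in> G"
  "seen_e (label_type x G D u) w \<longleftrightarrow> w \<le> x \<and> ERel w u \<in> G"
  "named (label_type x G D u) w \<longleftrightarrow> w \<le> x \<and> w = u"
  by (auto simp: set_decode_label_type)

locale saturated_pair =
  fixes L :: logic and CS :: "fm set" and G D :: "item set" and x :: nat
  assumes saturated: "saturated L CS G D"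
begin

abbreviation "ty \<equiv> label_type x G D"

lemma adds_closed: "adds L CS P y \<Longrightarrow> P \<subseteq> G \<Longrightarrow> y \<in> G"
  using saturated unfolding saturated_def by blast

lemma left: "y \<in> G \<Longrightarrow> left_reducible y \<Longrightarrow> left_done G D y"
  using saturated unfolding saturated_def by blast

lemma right: "y \<in> D \<Longrightarrow> right_reducible G y \<Longrightarrow> right_done G D y"
  using saturated unfolding saturated_def by blast

lemma Falsum_notin: "w \<^bold>\<tturnstile> \<^bold>\<bottom> \<notin> G"
  using saturated unfolding saturated_def by blast

lemma disjoint: "y \<in> G \<Longrightarrow> y \<in> D \<Longrightarrow> \<exists>w A. y = w \<^bold>\<tturnstile> A \<and> (\<forall>p. A \<noteq> PVar p)"
  using saturated unfolding saturated_def by blast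

text \<open>The formula always has a source w that sees u: either a label from which it was
  inherited or, by reflexivity, u itself. Transitivity makes w see v, and (L Box) is applied at the
  source.\<close>

lemma inherited_Box:
  assumes "inherited G u (\<^bold>\<box> A)" "Rel u v \<in> G"
  shows "inherited G v (\<^bold>\<box> A)" "v \<^bold>\<tturnstile> A \<in> G"
proof -
  obtain w where w: "Rel w u \<in> G" "w \<^bold>\<tturnstile> \<^bold>\<box> A \<in> G"
    using assms(1) adds_closed[OF adds.Ref] by (auto simp: inherited_def)
  then have "Rel w v \<in> G" using adds_closed[OF adds.Trans, of w u v] assms(2) by simp
  then show "inherited G v (\<^bold>\<box> A)" "v \<^bold>\<tturnstile> A \<in> G"
    using w adds_closed[OF adds.Box, of w A v] by (auto simp: inherited_def)
qed

text \<open>The same argument along evidence atoms; in addition the source acquires the evidence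
  atom by (E), and (Mon) carries it to v.\<close>

lemma inherited_Just:
  assumes "inherited G u (t \<^bold>: A)" "ERel u v \<in> G"
  shows "inherited G v (t \<^bold>: A)" "v \<^bold>\<tturnstile> A \<in> G" "Evid v t A \<in> G"
proof -
  obtain w where w: "ERel w u \<in> G" "w \<^bold>\<tturnstile> t \<^bold>: A \<in> G"
    using assms(1) adds_closed[OF adds.RefE] by (auto simp: inherited_def)
  then have wv: "ERel w v \<in> G" using adds_closed[OF adds.TransE, of w u v] assms(2) by simp
  have "Evid w t A \<in> G" using w adds_closed[OF adds.E, of w t A] by simp
  then show "inherited G v (t \<^bold>: A)" "v \<^bold>\<tturnstile> A \<in> G" "Evid v t A \<in> G"
    using w wv adds_closed[OF adds.Just, of w t A v] adds_closed[OF adds.Mon, of w t A v]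
    by (auto simp: inherited_def)
qed

lemma inherited_self: "inherited G u (\<^bold>\<box> A) \<Longrightarrow> u \<^bold>\<tturnstile> A \<in> G"
    "inherited G u (t \<^bold>: A) \<Longrightarrow> u \<^bold>\<tturnstile> A \<in> G" "inherited G u (t \<^bold>: A) \<Longrightarrow> Evid u t A \<in> G"
  using inherited_Box(2)[of u A u] inherited_Just(2,3)[of u t A u]
    adds_closed[OF adds.Ref] adds_closed[OF adds.RefE] by auto

lemma inherited_iff:
  "inherited G u (PVar p) \<longleftrightarrow> u \<^bold>\<tturnstile> PVar p \<in> G"
  "\<not> inherited G u \<^bold>\<bottom>"
  "inherited G u (\<^bold>\<not> A) \<longleftrightarrow> u \<^bold>\<tturnstile> \<^bold>\<not> A \<in> G"
  "inherited G u (A \<^bold>\<and> B) \<longleftrightarrow> u \<^bold>\<tturnstile> A \<^bold>\<and> B \<in> G"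
  "inherited G u (A \<^bold>\<or> B) \<longleftrightarrow> u \<^bold>\<tturnstile> A \<^bold>\<or> B \<in> G"
  "inherited G u (A \<^bold>\<rightarrow> B) \<longleftrightarrow> u \<^bold>\<tturnstile> A \<^bold>\<rightarrow> B \<in> G"
  by (auto simp: inherited_def Falsum_notin)

lemma inheritedI: "u \<^bold>\<tturnstile> A \<in> G \<Longrightarrow> inherited G u A"
  by (simp add: inherited_def)

lemma le_e_label_type:
  assumes "ERel u v \<in> G"
  shows "le_e x (ty u) (ty v)"
proof -
  have "Evid v t A \<in> G" if "Evid u t A \<in> G" for t A
    using adds_closed[OF adds.Mon, of u t A v] that assms by simp
  moreover have "ERel w v \<in> G" if "ERel w u \<in> G" for w
    using adds_closed[OF adds.TransE, of w u v] that assms by simp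
  moreover have "inherited G v A" if "pr 6 (pr t a) = fm_code A" "inherited G u A" for t a A
    using that inherited_Just(1) assms by (auto simp: pr_eq_fm_code)
  ultimately show ?thesis unfolding le_e_def label_type_facts by blast
qed

lemma acc_e_label_type:
  assumes "ERel u v \<in> G"
  shows "acc_e L x (ty u) (ty v)"
  using le_e_label_type assms adds_closed[OF adds.SymE, of u v] by (simp add: acc_e_def)

lemma acc_label_type:
  assumes "Rel u v \<in> G"
  shows "acc L x (ty u) (ty v)"
proof -
  have "ERel u v \<in> G" using adds_closed[OF adds.RE, of u v] assms by simp
  then have "acc_e L x (ty u) (ty v)" by (rule acc_e_label_type)
  moreover have "Rel w v \<in> G" if "Rel w u \<in> G" for w
    using adds_closed[OF adds.Trans, of w u v] that assms by simp
  moreover have "inherited G v A" if "pr 7 a = fm_code A" "inherited G u A" for a A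
    using that inherited_Box(1) assms by (auto simp: pr_eq_fm_code)
  ultimately show ?thesis unfolding acc_def label_type_facts by blast
qed

lemma truth_ok_label_type: "truth_ok x (ty u)"
proof -
  have neg: "u \<^bold>\<tturnstile> \<^bold>\<not> A \<in> G \<Longrightarrow> u \<^bold>\<tturnstile> A \<in> D" "u \<^bold>\<tturnstile> \<^bold>\<not> A \<in> D \<Longrightarrow> u \<^bold>\<tturnstile> A \<in> G" for A
    using left[of "u \<^bold>\<tturnstile> \<^bold>\<not> A"] right[of "u \<^bold>\<tturnstile> \<^bold>\<not> A"] by auto
  have con: "u \<^bold>\<tturnstile> A \<^bold>\<and> B \<in> G \<Longrightarrow> u \<^bold>\<tturnstile> A \<in> G \<and> u \<^bold>\<tturnstile> B \<in> G"
      "u \<^bold>\<tturnstile> A \<^bold>\<and> B \<in> D \<Longrightarrow> u \<^bold>\<tturnstile> A \<in> D \<or> u \<^bold>\<tturnstile> B \<in> D" for A B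
    using left[of "u \<^bold>\<tturnstile> A \<^bold>\<and> B"] right[of "u \<^bold>\<tturnstile> A \<^bold>\<and> B"] by auto
  have dis: "u \<^bold>\<tturnstile> A \<^bold>\<or> B \<in> G \<Longrightarrow> u \<^bold>\<tturnstile> A \<in> G \<or> u \<^bold>\<tturnstile> B \<in> G"
      "u \<^bold>\<tturnstile> A \<^bold>\<or> B \<in> D \<Longrightarrow> u \<^bold>\<tturnstile> A \<in> D \<and> u \<^bold>\<tturnstile> B \<in> D" for A B
    using left[of "u \<^bold>\<tturnstile> A \<^bold>\<or> B"] right[of "u \<^bold>\<tturnstile> A \<^bold>\<or> B"] by auto
  have imp: "u \<^bold>\<tturnstile> A \<^bold>\<rightarrow> B \<in> G \<Longrightarrow> u \<^bold>\<tturnstile> A \<in> D \<or> u \<^bold>\<tturnstile> B \<in> G"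
      "u \<^bold>\<tturnstile> A \<^bold>\<rightarrow> B \<in> D \<Longrightarrow> u \<^bold>\<tturnstile> A \<in> G \<and> u \<^bold>\<tturnstile> B \<in> D" for A B
    using left[of "u \<^bold>\<tturnstile> A \<^bold>\<rightarrow> B"] right[of "u \<^bold>\<tturnstile> A \<^bold>\<rightarrow> B"] by auto
  have var: "u \<^bold>\<tturnstile> PVar p \<notin> D" if "u \<^bold>\<tturnstile> PVar p \<in> G" for p
    using disjoint[OF that] by auto
  have trI: "tr (ty u) (fm_code A)" if "fm_code A \<le> x" "u \<^bold>\<tturnstile> A \<in> G" for A
    using that inheritedI label_type_facts(1) by blast
  have faI: "fa (ty u) (fm_code A)" if "fm_code A \<le> x" "u \<^bold>\<tturnstile> A \<in> D" for A
    using that label_type_facts(2) by blast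
  note facts = label_type_facts label_type_facts(2)[unfolded One_nat_def] pr_eq_fm_code inherited_iff
  have unary: "tr (ty u) (pr 2 a) \<longrightarrow> fa (ty u) a" "fa (ty u) (pr 2 a) \<longrightarrow> tr (ty u) a"
    "tr (ty u) (pr 7 a) \<longrightarrow> tr (ty u) a" if "a \<le> x" for a
  proof safe
    assume "tr (ty u) (pr 2 a)"
    then obtain A where "a = fm_code A" "u \<^bold>\<tturnstile> \<^bold>\<not> A \<in> G" by (auto simp: facts)
    with that neg(1) faI show "fa (ty u) a" by blast
  next
    assume "fa (ty u) (pr 2 a)"
    then obtain A where "a = fm_code A" "u \<^bold>\<tturnstile> \<^bold>\<not> A \<in> D" by (auto simp: facts)
    with that neg(2) trI show "tr (ty u) a" by blast
  next
    assume "tr (ty u) (pr 7 a)"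
    then obtain A where "a = fm_code A" "inherited G u (\<^bold>\<box> A)" by (auto simp: facts)
    with that inherited_self(1) trI show "tr (ty u) a" by blast
  qed
  have binary:
    "tr (ty u) (pr 3 (pr a b)) \<Longrightarrow> tr (ty u) a \<and> tr (ty u) b"
    "fa (ty u) (pr 3 (pr a b)) \<Longrightarrow> fa (ty u) a \<or> fa (ty u) b"
    "tr (ty u) (pr 4 (pr a b)) \<Longrightarrow> tr (ty u) a \<or> tr (ty u) b"
    "fa (ty u) (pr 4 (pr a b)) \<Longrightarrow> fa (ty u) a \<and> fa (ty u) b"
    "tr (ty u) (pr 5 (pr a b)) \<Longrightarrow> fa (ty u) a \<or> tr (ty u) b"
    "fa (ty u) (pr 5 (pr a b)) \<Longrightarrow> tr (ty u) a \<and> fa (ty u) b" if le: "a \<le> x" "b \<le> x" for a b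
  proof -
    assume "tr (ty u) (pr 3 (pr a b))"
    then obtain A B where "a = fm_code A" "b = fm_code B" "u \<^bold>\<tturnstile> A \<^bold>\<and> B \<in> G"
      by (auto simp: facts)
    with le con(1) trI faI show "tr (ty u) a \<and> tr (ty u) b" by blast
  next
    assume "fa (ty u) (pr 3 (pr a b))"
    then obtain A B where "a = fm_code A" "b = fm_code B" "u \<^bold>\<tturnstile> A \<^bold>\<and> B \<in> D"
      by (auto simp: facts)
    with le con(2) trI faI show "fa (ty u) a \<or> fa (ty u) b" by blast
  next
    assume "tr (ty u) (pr 4 (pr a b))"
    then obtain A B where "a = fm_code A" "b = fm_code B" "u \<^bold>\<tturnstile> A \<^bold>\<or> B \<in> G"
      by (auto simp: facts)
    with le dis(1) trI faI show "tr (ty u) a \<or> tr (ty u) b" by blast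
  next
    assume "fa (ty u) (pr 4 (pr a b))"
    then obtain A B where "a = fm_code A" "b = fm_code B" "u \<^bold>\<tturnstile> A \<^bold>\<or> B \<in> D"
      by (auto simp: facts)
    with le dis(2) trI faI show "fa (ty u) a \<and> fa (ty u) b" by blast
  next
    assume "tr (ty u) (pr 5 (pr a b))"
    then obtain A B where "a = fm_code A" "b = fm_code B" "u \<^bold>\<tturnstile> A \<^bold>\<rightarrow> B \<in> G"
      by (auto simp: facts)
    with le imp(1) trI faI show "fa (ty u) a \<or> tr (ty u) b" by blast
  next
    assume "fa (ty u) (pr 5 (pr a b))"
    then obtain A B where "a = fm_code A" "b = fm_code B" "u \<^bold>\<tturnstile> A \<^bold>\<rightarrow> B \<in> D"
      by (auto simp: facts)
    with le imp(2) trI faI show "tr (ty u) a \<and> fa (ty u) b" by blast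
  qed
  have just: "tr (ty u) (pr 6 (pr t a)) \<longrightarrow> tr (ty u) a \<and> ev (ty u) t a" if "t \<le> x" "a \<le> x" for t a
  proof
    assume "tr (ty u) (pr 6 (pr t a))"
    then obtain s A where "t = tm_code s" "a = fm_code A" "inherited G u (s \<^bold>: A)"
      by (auto simp: facts)
    with that inherited_self(2,3) trI label_type_facts(3) show "tr (ty u) a \<and> ev (ty u) t a" by blast
  qed
  have atoms: "\<not> (tr (ty u) (pr 0 p) \<and> fa (ty u) (pr 0 p))" "\<not> tr (ty u) (pr 1 0)" for p
    using var unfolding label_type_facts
    by (auto simp: pr_eq_fm_code inherited_iff)
  show ?thesis unfolding truth_ok_def
    by (rule atoms unary binary just allI conjI impI | assumption)+
qed

lemma evidence_ok_label_type: "evidence_ok x (ty u)"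
  unfolding evidence_ok_def
proof (intro conjI allI impI)
  fix s t a b assume le: "a \<le> x" "b \<le> x" "s \<le> x" "t \<le> x"
    and "ev (ty u) s (pr 5 (pr a b)) \<and> ev (ty u) t a \<and> pr 2 (pr s t) \<le> x"
  then obtain s' t' A B where "s = tm_code s'" "t = tm_code t'" "a = fm_code A" "b = fm_code B"
      "Evid u s' (A \<^bold>\<rightarrow> B) \<in> G" "Evid u t' A \<in> G" "pr 2 (pr s t) \<le> x"
    unfolding label_type_facts by (auto simp: pr_eq_fm_code)
  moreover from this have "Evid u (s' \<^bold>\<cdot> t') B \<in> G"
    using adds_closed[OF adds.App, of u s' A B t'] by simp
  ultimately show "ev (ty u) (pr 2 (pr s t)) b"
    unfolding label_type_facts using le by (intro exI[of _ "s' \<^bold>\<cdot> t'"] exI[of _ B]) simp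
next
  fix s t a assume "s \<le> x" and *: "term_code x s \<and> ev (ty u) t a \<and> pr 3 (pr s t) \<le> x"
  then obtain s' t' A where "s = tm_code s'" "t = tm_code t'" "a = fm_code A" "fm_code A \<le> x"
      "Evid u t' A \<in> G" "pr 3 (pr s t) \<le> x"
    unfolding label_type_facts by (auto simp: term_code_iff)
  moreover from this have "Evid u (s' \<^bold>+ t') A \<in> G"
    using adds_closed[OF adds.SumL, of u t' A s'] by simp
  ultimately show "ev (ty u) (pr 3 (pr s t)) a"
    unfolding label_type_facts by (intro exI[of _ "s' \<^bold>+ t'"] exI[of _ A]) simp
next
  fix s t a assume "s \<le> x" and *: "term_code x s \<and> ev (ty u) t a \<and> pr 3 (pr t s) \<le> x"
  then obtain s' t' A where "s = tm_code s'" "t = tm_code t'" "a = fm_code A" "fm_code A \<le> x"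
      "Evid u t' A \<in> G" "pr 3 (pr t s) \<le> x"
    unfolding label_type_facts by (auto simp: term_code_iff)
  moreover from this have "Evid u (t' \<^bold>+ s') A \<in> G"
    using adds_closed[OF adds.SumR, of u t' A s'] by simp
  ultimately show "ev (ty u) (pr 3 (pr t s)) a"
    unfolding label_type_facts by (intro exI[of _ "t' \<^bold>+ s'"] exI[of _ A]) simp
next
  fix t a assume "ev (ty u) t a \<and> pr 4 t \<le> x \<and> pr 6 (pr t a) \<le> x"
  then obtain t' A where "t = tm_code t'" "a = fm_code A" "Evid u t' A \<in> G"
      "pr 4 t \<le> x" "pr 6 (pr t a) \<le> x"
    unfolding label_type_facts by auto
  moreover from this have "Evid u (\<^bold>! t') (t' \<^bold>: A) \<in> G"
    using adds_closed[OF adds.Bang, of u t' A] by simp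
  ultimately show "ev (ty u) (pr 4 t) (pr 6 (pr t a))"
    unfolding label_type_facts by (intro exI[of _ "\<^bold>! t'"] exI[of _ "t' \<^bold>: A"]) simp
qed

lemma label_type_countermodel:
  assumes CS: "CS = set cs" and cs_le: "\<And>A. A \<in> set cs \<Longrightarrow> fm_code A \<le> x"
    and \<Gamma>: "set \<Gamma> \<subseteq> G" and \<Delta>: "set \<Delta> \<subseteq> D"
  shows "\<exists>W<2 ^ 2 ^ Suc (pr 5 (pr x x)). countermodel L x (list_encode (map fm_code cs))
    (list_encode (map item_code \<Gamma>)) (list_encode (map item_code \<Delta>)) W"
proof (intro exI conjI)
  let ?W = "set_encode (range ty)" and ?cs = "list_encode (map fm_code cs)"
  let ?g = "list_encode (map item_code \<Gamma>)" and ?d = "list_encode (map item_code \<Delta>)"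
  have sub: "range ty \<subseteq> {..<2 ^ Suc (pr 5 (pr x x))}" using label_type_less by blast
  then show "?W < 2 ^ 2 ^ Suc (pr 5 (pr x x))" by (rule set_encode_less)
  have dec: "set_decode ?W = range ty"
    by (rule set_encode_inverse[OF finite_subset[OF sub]]) simp
  have le_W: "ty u \<le> ?W" for u using set_decode_less[of "ty u" ?W] dec by auto
  have ex: "\<exists>\<sigma>\<le>?W. \<sigma> \<in> set_decode ?W \<and> P \<sigma>" if "P (ty u)" for P u
    using that le_W dec by auto
  have world: "world_ok L x ?cs ?W (ty u)" for u
    unfolding world_ok_def
  proof (intro conjI allI impI)
    show "truth_ok x (ty u)" "evidence_ok x (ty u)"
      by (rule truth_ok_label_type evidence_ok_label_type)+
  next
    fix c a assume le: "c \<le> x" "a \<le> x" and mem: "list_mem (pr 6 (pr (pr 1 c) a)) ?cs"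
    from mem obtain F where F: "pr 6 (pr (pr 1 c) a) = fm_code F" "F \<in> CS"
      unfolding list_mem_list_encode CS by auto
    then obtain t A where tA: "F = t \<^bold>: A" "pr 1 c = tm_code t" "a = fm_code A"
      by (auto simp: pr_eq_fm_code)
    then have "t = JConst c" by (metis code_simps(2) tm_code_inject)
    then have "Evid u (JConst c) A \<in> G" using adds_closed[OF adds.AN, of c A u] F tA by simp
    \<comment> \<open>The assumption \<open>c \<le> x\<close> does not bound \<open>pr 1 c\<close>;
      that bound comes from the code of the whole formula F of the constant specification.\<close>
    moreover have "tm_code (JConst c) \<le> x"
      using cs_le[of F] F tA unfolding CS by (auto dest: pr_le_D)
    ultimately show "ev (ty u) (pr 1 c) a"
      unfolding label_type_facts using le tA \<open>t = JConst c\<close> by blast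
  next
    fix a assume "fa (ty u) (pr 7 a)"
    then obtain A where A: "a = fm_code A" "fm_code (\<^bold>\<box> A) \<le> x" "u \<^bold>\<tturnstile> \<^bold>\<box> A \<in> D"
      unfolding label_type_facts by (auto simp: pr_eq_fm_code)
    then obtain v where "Rel u v \<in> G" "v \<^bold>\<tturnstile> A \<in> D" using right[of "u \<^bold>\<tturnstile> \<^bold>\<box> A"] by auto
    moreover have "fm_code A \<le> x" using A(2) by (auto dest: pr_le_D)
    ultimately have "acc L x (ty u) (ty v) \<and> fa (ty v) a"
      using acc_label_type A(1) label_type_facts(2) by blast
    then show "\<exists>\<sigma>\<le>?W. \<sigma> \<in> set_decode ?W \<and> acc L x (ty u) \<sigma> \<and> fa \<sigma> a" by (rule ex)
  next
    fix t' a assume "fa (ty u) (pr 6 (pr t' a)) \<and> ev (ty u) t' a"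
    then obtain t A where A: "t' = tm_code t" "a = fm_code A" "fm_code (t \<^bold>: A) \<le> x" "u \<^bold>\<tturnstile> t \<^bold>: A \<in> D"
        "Evid u t A \<in> G"
      unfolding label_type_facts by (auto simp: pr_eq_fm_code)
    then obtain v where "ERel u v \<in> G" "v \<^bold>\<tturnstile> A \<in> D" using right[of "u \<^bold>\<tturnstile> t \<^bold>: A"] by auto
    moreover have "fm_code A \<le> x" using A(3) by (auto dest!: pr_le_D)
    ultimately have "acc_e L x (ty u) (ty v) \<and> fa (ty v) a"
      using acc_e_label_type A(2) label_type_facts(2) by blast
    then show "\<exists>\<sigma>\<le>?W. \<sigma> \<in> set_decode ?W \<and> acc_e L x (ty u) \<sigma> \<and> fa \<sigma> a" by (rule ex)
  qed
  have memG: "y \<in> G" if "list_mem (item_code y) ?g" for y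
    using that \<Gamma> unfolding list_mem_map_code by blast
  have memD: "y \<in> D" if "list_mem (item_code y) ?d" for y
    using that \<Delta> unfolding list_mem_map_code by blast
  have item: "item_ok x ?g ?d (ty u) u" for u
    unfolding item_ok_def
  proof (intro conjI allI impI)
    fix a assume a: "a \<le> x" "list_mem (pr 0 (pr u a)) ?g"
    then obtain A where "a = fm_code A" "u \<^bold>\<tturnstile> A \<in> G"
      using \<Gamma> unfolding list_mem_list_encode by (auto simp: pr_eq_item_code subset_iff)
    then show "tr (ty u) a" using a(1) inheritedI label_type_facts(1) by blast
  next
    fix a assume a: "a \<le> x" "list_mem (pr 0 (pr u a)) ?d"
    then obtain A where "a = fm_code A" "u \<^bold>\<tturnstile> A \<in> D"
      using \<Delta> unfolding list_mem_list_encode by (auto simp: pr_eq_item_code subset_iff)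
    then show "fa (ty u) a" using a(1) label_type_facts(2) by blast
  next
    fix a t' assume le: "a \<le> x" "t' \<le> x" and "list_mem (pr 3 (pr u (pr t' a))) ?g"
    then obtain t A where "t' = tm_code t" "a = fm_code A" "Evid u t A \<in> G"
      using \<Gamma> unfolding list_mem_list_encode by (auto simp: pr_eq_item_code subset_iff)
    then show "ev (ty u) t' a" using le label_type_facts(3) by blast
  next
    fix a t' assume "list_mem (pr 3 (pr u (pr t' a))) ?d"
    then obtain t A where "t' = tm_code t" "a = fm_code A" "Evid u t A \<in> D"
      using \<Delta> unfolding list_mem_list_encode by (auto simp: pr_eq_item_code subset_iff)
    then show "\<not> ev (ty u) t' a"
      using disjoint[of "Evid u t A"] unfolding label_type_facts by auto
  qed
  have atom: "atom_ok L x ?g ?d (ty u) (ty v) u v" if le: "u \<le> x" "v \<le> x" for u v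
  proof -
    \<comment> \<open>Reflection of atoms: u sees itself, so the input-range label u is recorded as
      \<open>seen_e\<close> in its own type. Preservation puts the record into the type of v, and
      there it means \<open>ERel u v\<close>. The argument for \<open>Rel\<close> is the same with
      \<open>seen\<close>.\<close>
    have "ERel u v \<in> G" if "acc_e L x (ty u) (ty v)"
      using that le adds_closed[OF adds.RefE, of u] unfolding acc_e_def le_e_def label_type_facts
      by auto
    moreover have "Rel u v \<in> G" if "acc L x (ty u) (ty v)"
      using that le adds_closed[OF adds.Ref, of u] unfolding acc_def label_type_facts by auto
    moreover have "Rel u v \<notin> D" if "Rel u v \<in> G" using disjoint[OF that] by auto
    moreover have "ERel u v \<notin> D" if "ERel u v \<in> G" using disjoint[OF that] by auto
    ultimately show ?thesis
      using acc_label_type acc_e_label_type memG[of "Rel u v"] memG[of "ERel u v"]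
        memD[of "Rel u v"] memD[of "ERel u v"]
      unfolding atom_ok_def by auto
  qed
  show "countermodel L x ?cs ?g ?d ?W"
    unfolding countermodel_def
  proof (intro conjI allI impI)
    fix \<tau> assume "\<tau> \<in> set_decode ?W"
    then show "world_ok L x ?cs ?W \<tau>" using world dec by auto
  next
    fix w assume "w \<le> x"
    then show "\<exists>\<tau>\<le>?W. \<tau> \<in> set_decode ?W \<and> named \<tau> w" by (intro ex) (simp add: label_type_facts)
  next
    fix \<tau> w assume "\<tau> \<in> set_decode ?W" "named \<tau> w"
    then show "item_ok x ?g ?d \<tau> w" using item dec by (auto simp: label_type_facts)
  next
    fix \<tau> w \<sigma> v assume "\<tau> \<in> set_decode ?W" "named \<tau> w" "\<sigma> \<in> set_decode ?W" "named \<sigma> v"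
    then show "atom_ok L x ?g ?d \<tau> \<sigma> w v" using atom dec by (auto simp: label_type_facts)
  qed
qed

end

text \<open>Here x has two roles, as the input to be decoded and as the bound on all relevant codes.
  They agree because lists and pairs dominate their entries; injectivity of \<open>pr\<close> makes
  the decoding unique.\<close>

lemma refutable_input_code:
  "refutable L (input_code (cs, \<Gamma>, \<Delta>)) \<longleftrightarrow> \<not> G3 L (set cs) (mset \<Gamma>) (mset \<Delta>)"
proof -
  define c g d x where "c = list_encode (map fm_code cs)" and "g = list_encode (map item_code \<Gamma>)"
    and "d = list_encode (map item_code \<Delta>)" and "x = input_code (cs, \<Gamma>, \<Delta>)"
  have x: "x = pr c (pr g d)" by (simp add: x_def c_def g_def d_def pr_def)
  then have le: "c \<le> x" "g \<le> x" "d \<le> x" using le_pr order_trans by metis+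
  have cs_le: "fm_code A \<le> x" if "A \<in> set cs" for A
    using that le_list_encode[of "fm_code A" "map fm_code cs"] le(1) by (auto simp: c_def)
  have item_le: "item_code y \<le> x" if "y \<in> set \<Gamma> \<union> set \<Delta>" for y
    using that le_list_encode[of "item_code y" "map item_code \<Gamma>"]
      le_list_encode[of "item_code y" "map item_code \<Delta>"] le(2,3) by (auto simp: g_def d_def)
  have "refutable L x \<longleftrightarrow> (\<exists>W<2 ^ 2 ^ Suc (pr 5 (pr x x)). countermodel L x c g d W)"
  proof
    assume "refutable L x"
    then obtain c' g' d' where "x = pr c' (pr g' d')"
        "\<exists>W<2 ^ 2 ^ Suc (pr 5 (pr x x)). countermodel L x c' g' d' W"
      unfolding refutable_def by blast
    then show "\<exists>W<2 ^ 2 ^ Suc (pr 5 (pr x x)). countermodel L x c g d W" using x by simp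
  next
    assume "\<exists>W<2 ^ 2 ^ Suc (pr 5 (pr x x)). countermodel L x c g d W"
    then show "refutable L x" unfolding refutable_def using le x by blast
  qed
  also have "\<dots> \<longleftrightarrow> \<not> G3 L (set cs) (mset \<Gamma>) (mset \<Delta>)"
  proof
    assume "\<exists>W<2 ^ 2 ^ Suc (pr 5 (pr x x)). countermodel L x c g d W"
    then show "\<not> G3 L (set cs) (mset \<Gamma>) (mset \<Delta>)"
      using countermodel_sound cs_le item_le unfolding c_def g_def d_def by blast
  next
    assume "\<not> G3 L (set cs) (mset \<Gamma>) (mset \<Delta>)"
    then obtain G D where GD: "saturated L (set cs) G D" "set \<Gamma> \<subseteq> G" "set \<Delta> \<subseteq> D"
      using saturation by fastforce
    interpret saturated_pair L "set cs" G D x by unfold_locales (rule GD(1))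
    show "\<exists>W<2 ^ 2 ^ Suc (pr 5 (pr x x)). countermodel L x c g d W"
      unfolding c_def g_def d_def by (rule label_type_countermodel[OF refl cs_le GD(2,3)])
  qed
  finally show ?thesis by (simp only: x_def)
qed

lemma decidable_G3:
  "decidable_problem input_code I (\<lambda>(cs, \<Gamma>, \<Delta>). G3 L (set cs) (mset \<Gamma>) (mset \<Delta>))"
proof -
  have "decidable_rel (Suc 0) (\<lambda>e. \<not> refutable L (hd e))"
    by (rule decidable_rel_not[OF decidable_rel_refutable])
  then obtain f where f: "recursive 1 f" "\<And>e. length e = 1 \<Longrightarrow> of_bool (\<not> refutable L (hd e)) = f e"
    unfolding decidable_rel_def computable_def One_nat_def by blast
  have "f [input_code z] = (if case z of (cs, \<Gamma>, \<Delta>) \<Rightarrow> G3 L (set cs) (mset \<Gamma>) (mset \<Delta>) then 1 else 0)" for z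
  proof (cases z)
    case (fields cs \<Gamma> \<Delta>)
    then show ?thesis
      using f(2)[of "[input_code z]"] refutable_input_code[of L cs \<Gamma> \<Delta>]
      by (cases "G3 L (set cs) (mset \<Gamma>) (mset \<Delta>)") (auto simp del: input_code.simps)
  qed
  with f(1) show ?thesis unfolding decidable_problem_def by blast
qed

theorem theorem10p15:
  shows "decidable_problem input_code
           {(cs, \<Gamma>, \<Delta>). constant_spec S4LPN (set cs)}
           (\<lambda>(cs, \<Gamma>, \<Delta>). G3 S4LPN (set cs) (mset \<Gamma>) (mset \<Delta>))
       \<and> decidable_problem input_code
           {(cs, \<Gamma>, \<Delta>). constant_spec S4LP (set cs)}
           (\<lambda>(cs, \<Gamma>, \<Delta>). G3 S4LP (set cs) (mset \<Gamma>) (mset \<Delta>))"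
  by (intro conjI decidable_G3)

end
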